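(* Let $G$ be a finite simple connected undirected vertex-transitive graph with $N$ vertices and normalized graph Laplacian $L$, and let $a\ge0$, $q\ge0$, $c>0$. For any $T>0$, the solution $R(t)$ to the matrix-valued ODE $$R'(t)=\frac1c\,\mathrm{Tr}\left[Q'(R(t))\,e^{-t(a+q)L}\right]e^{-t(a+q)L},\qquad R(0)=0,$$ where $Q(X):=[\det(I+cXL)]^{1/N}$ for $X\in\mathscr{X}$, exists and is unique in $\mathscr{X}$ on the finite time horizon $t\in[0,T]$.
   Context: For a graph $G=(V,E)$ with $V=\{v_1,\dots,v_N\}$ and degrees $d_{v_i}$, the normalized graph Laplacian $L$ is the symmetric $N\times N$ matrix with $L_{ii}=1$, $L_{ij}=-1/\sqrt{d_{v_i}d_{v_j}}$ if $i\neq j$ and $v_i$, $v_j$ are adjacent, $L_{ij}=0$ otherwise. $G$ is vertex-transitive if for any two vertices $u,v$ there is a graph automorphism mapping $u$ to $v$. $\mathscr{X}:=\{X: X\ge0,\ X\text{ is a polynomial of }L\}$, a subset of the real symmetric $N\times N$ matrices, where $X\ge 0$ means positive semi-definite. $Q'(X)$ denotes the matrix derivative of $Q$, i.e. $Q'(X)=\frac1N[\det(I+cXL)]^{1/N}(I+cXL)^{-1}cL$ for $X\in\mathscr{X}$. *)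

theory Defs
  imports "HOL-Analysis.Analysis" "HOL-Computational_Algebra.Polynomial"
begin

section \<open>Graphs\<close>

text \<open>The vertex set is the whole finite type \<open>'n\<close>, so that \<open>N = CARD('n)\<close> and
  \<open>N \<times> N\<close> matrices have type \<open>real ^ 'n ^ 'n\<close>.\<close>

locale simple_graph =
  fixes adj :: "'n::finite \<Rightarrow> 'n \<Rightarrow> bool"
  assumes adj_sym: "adj u v \<Longrightarrow> adj v u"
    and adj_irrefl: "\<not> adj v v"

definition connected_graph :: "('n::finite \<Rightarrow> 'n \<Rightarrow> bool) \<Rightarrow> bool" where
  "connected_graph adj \<longleftrightarrow> (\<forall>u v. adj\<^sup>*\<^sup>* u v)"

definition graph_automorphism :: "('n::finite \<Rightarrow> 'n \<Rightarrow> bool) \<Rightarrow> ('n \<Rightarrow> 'n) \<Rightarrow> bool" where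
  "graph_automorphism adj f \<longleftrightarrow> bij f \<and> (\<forall>u v. adj (f u) (f v) \<longleftrightarrow> adj u v)"

definition vertex_transitive :: "('n::finite \<Rightarrow> 'n \<Rightarrow> bool) \<Rightarrow> bool" where
  "vertex_transitive adj \<longleftrightarrow> (\<forall>u v. \<exists>f. graph_automorphism adj f \<and> f u = v)"

definition degree_of :: "('n::finite \<Rightarrow> 'n \<Rightarrow> bool) \<Rightarrow> 'n \<Rightarrow> nat" where
  "degree_of adj v = card {u. adj v u}"

definition norm_laplacian :: "('n::finite \<Rightarrow> 'n \<Rightarrow> bool) \<Rightarrow> real ^ 'n ^ 'n" where
  "norm_laplacian adj = (\<chi> i j.
     if i = j then 1
     else if adj i j then - 1 / sqrt (real (degree_of adj i) * real (degree_of adj j))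
     else 0)"

section \<open>Matrix functions\<close>

text \<open>The multiplication of the type class \<open>times\<close> on \<open>real ^ 'n ^ 'n\<close> is componentwise,
  so powers, polynomials and the exponential are defined here from the matrix product.\<close>

primrec matpow :: "real ^ 'n ^ 'n \<Rightarrow> nat \<Rightarrow> real ^ 'n ^ 'n" where
  "matpow A 0 = mat 1"
| "matpow A (Suc k) = A ** matpow A k"

definition matpoly :: "real poly \<Rightarrow> real ^ 'n ^ 'n \<Rightarrow> real ^ 'n ^ 'n" where
  "matpoly p A = (\<Sum>k\<le>degree p. coeff p k *\<^sub>R matpow A k)"

definition matexp :: "real ^ 'n ^ 'n \<Rightarrow> real ^ 'n ^ 'n" where
  "matexp A = (\<Sum>k. (1 / fact k) *\<^sub>R matpow A k)"

definition pos_semidef :: "real ^ 'n ^ 'n \<Rightarrow> bool" where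
  "pos_semidef A \<longleftrightarrow> transpose A = A \<and> (\<forall>x. 0 \<le> x \<bullet> (A *v x))"

definition psd_polys :: "real ^ 'n ^ 'n \<Rightarrow> (real ^ 'n ^ 'n) set" where
  "psd_polys L = {X. pos_semidef X \<and> (\<exists>p. X = matpoly p L)}"

definition Qfun :: "real \<Rightarrow> real ^ 'n ^ 'n \<Rightarrow> real ^ 'n ^ 'n \<Rightarrow> real" where
  "Qfun c L X = root CARD('n) (det (mat 1 + c *\<^sub>R (X ** L)))"

text \<open>The matrix derivative of \<open>Qfun c L\<close> on \<open>psd_polys L\<close>; the lemma
  \<open>Qfun_has_derivative\<close> below confirms the formula, with the trace pairing
  \<open>H \<mapsto> Tr (Q'(X) H)\<close>.\<close>

definition Qderiv :: "real \<Rightarrow> real ^ 'n ^ 'n \<Rightarrow> real ^ 'n ^ 'n \<Rightarrow> real ^ 'n ^ 'n" where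
  "Qderiv c L X =
     (1 / real CARD('n) * Qfun c L X) *\<^sub>R
       (matrix_inv (mat 1 + c *\<^sub>R (X ** L)) ** (c *\<^sub>R L))"

definition ode_solution ::
  "real \<Rightarrow> real \<Rightarrow> real \<Rightarrow> real ^ 'n ^ 'n \<Rightarrow> real \<Rightarrow> (real \<Rightarrow> real ^ 'n ^ 'n) \<Rightarrow> bool" where
  "ode_solution a q c L T R \<longleftrightarrow>
     R 0 = 0 \<and>
     (\<forall>t\<in>{0..T}. R t \<in> psd_polys L \<and>
       (R has_vector_derivative
          (1 / c * trace (Qderiv c L (R t) ** matexp ((- t * (a + q)) *\<^sub>R L))) *\<^sub>R
            matexp ((- t * (a + q)) *\<^sub>R L)) (at t within {0..T}))"

section \<open>Consistency checks\<close>

lemma matpow_bound: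
  fixes A :: "real ^ 'n ^ 'n"
  assumes "\<And>i j. \<bar>A $ i $ j\<bar> \<le> B"
  shows "\<bar>matpow A k $ i $ j\<bar> \<le> (real CARD('n) * B) ^ k"
proof (induction k arbitrary: i j)
  case 0
  show ?case by (simp add: mat_def)
next
  case (Suc k)
  have B: "0 \<le> B" using assms[of i j] by linarith
  have "\<bar>matpow A (Suc k) $ i $ j\<bar> \<le> (\<Sum>l\<in>UNIV. \<bar>A $ i $ l * matpow A k $ l $ j\<bar>)"
    by (simp add: matrix_matrix_mult_def sum_abs)
  also have "\<dots> \<le> (\<Sum>l\<in>(UNIV::'n set). B * (real CARD('n) * B) ^ k)"
    unfolding abs_mult using assms Suc B by (intro sum_mono mult_mono) auto
  finally show ?case by simp
qed

lemma matexp_sums: "(\<lambda>k. (1 / fact k) *\<^sub>R matpow A k) sums matexp A"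
proof -
  define B where "B = norm A"
  have B: "\<bar>A $ i $ j\<bar> \<le> B" for i j
    unfolding B_def using component_le_norm_cart[of "A $ i" j] Finite_Cartesian_Product.norm_nth_le[of A i]
    by linarith
  have *: "summable (\<lambda>k. ((1 / fact k) *\<^sub>R matpow A k) $ i $ j)" for i j
  proof (rule summable_comparison_test')
    show "summable (\<lambda>k. inverse (fact k) * (real CARD('a) * B) ^ k)"
      by (rule summable_exp)
    show "norm (((1 / fact k) *\<^sub>R matpow A k) $ i $ j) \<le> inverse (fact k) * (real CARD('a) * B) ^ k" for k
      using matpow_bound[of A B k i j, OF B]
      by (simp add: abs_mult divide_inverse mult_left_mono)
  qed
  have "(\<lambda>k. (1 / fact k) *\<^sub>R matpow A k) sums
      (\<chi> i j. suminf (\<lambda>k. ((1 / fact k) *\<^sub>R matpow A k) $ i $ j))"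
    unfolding sums_def
    apply (intro vec_tendstoI)
    using summable_LIMSEQ[OF *] by (simp add: sum_component)
  then show ?thesis
    unfolding matexp_def by (simp add: sums_iff)
qed

lemma scaleR_matrix_mult_left: "(r *\<^sub>R A) ** (B :: real^'n^'m) = r *\<^sub>R (A ** B)"
  by (simp add: vec_eq_iff matrix_matrix_mult_def sum_distrib_left mult.assoc)

lemma scaleR_matrix_mult_right: "A ** (r *\<^sub>R (B :: real^'n^'m)) = r *\<^sub>R (A ** B)"
  by (simp add: vec_eq_iff matrix_matrix_mult_def sum_distrib_left algebra_simps)

lemma matrix_add_mult_right: "(A + B) ** (C :: real^'n^'m) = A ** C + B ** C"
  by (simp add: vec_eq_iff matrix_matrix_mult_def sum.distrib distrib_right)

lemma matpow_commute: "matpow A k ** A = A ** matpow A k"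
  by (induction k) (auto simp flip: matrix_mul_assoc)

lemma matpoly_commute: "matpoly p A ** A = A ** matpoly p A"
proof -
  have "(\<Sum>k\<in>S. coeff p k *\<^sub>R matpow A k) ** A = A ** (\<Sum>k\<in>S. coeff p k *\<^sub>R matpow A k)"
    if "finite S" for S
    using that by (induction S)
      (auto simp: matpow_commute matrix_add_ldistrib matrix_add_mult_right
        scaleR_matrix_mult_left scaleR_matrix_mult_right)
  then show ?thesis by (simp add: matpoly_def)
qed

lemma det_has_derivative_mat_1:
  "(det has_derivative (\<lambda>H::real^'n^'n. trace H)) (at (mat 1))"
proof -
  let ?P = "{p. p permutes (UNIV::'n set)}"
  let ?M = "mat 1 :: real^'n^'n"
  have comp: "((\<lambda>A::real^'n^'n. A $ i $ j) has_derivative (\<lambda>H. H $ i $ j)) (at ?M)" for i j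
    by (intro bounded_linear_imp_has_derivative
        bounded_linear_compose[OF bounded_linear_vec_nth bounded_linear_vec_nth])
  have "(det has_derivative (\<lambda>H. \<Sum>p\<in>?P. of_int (sign p) *
          (\<Sum>i\<in>UNIV. H $ i $ p i * (\<Prod>j\<in>UNIV - {i}. ?M $ j $ p j)))) (at ?M)"
    unfolding det_def[abs_def]
    by (intro has_derivative_sum has_derivative_mult_right has_derivative_prod comp)
  moreover have "(\<Sum>p\<in>?P. of_int (sign p) *
          (\<Sum>i\<in>UNIV. H $ i $ p i * (\<Prod>j\<in>UNIV - {i}. ?M $ j $ p j))) = trace H" for H :: "real^'n^'n"
  proof -
    have zero: "(\<Prod>j\<in>UNIV - {i}. ?M $ j $ p j) = 0" if p: "p \<in> ?P - {id}" for p i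
    proof -
      have inj: "inj p" using p by (auto simp: permutes_inj)
      have "\<exists>j. j \<noteq> i \<and> p j \<noteq> j"
      proof (rule ccontr)
        assume "\<not> ?thesis"
        then have fix_: "\<And>j. j \<noteq> i \<Longrightarrow> p j = j" by blast
        have "p i = i" using fix_[of "p i"] inj by (metis injD)
        then have "p = id" using fix_ by (metis eq_id_iff)
        then show False using p by simp
      qed
      then obtain j where "j \<in> UNIV - {i}" "?M $ j $ p j = 0" by (auto simp: mat_def)
      then show ?thesis by (intro prod_zero) auto
    qed
    have "(\<Sum>p\<in>?P. of_int (sign p) *
          (\<Sum>i\<in>UNIV. H $ i $ p i * (\<Prod>j\<in>UNIV - {i}. ?M $ j $ p j))) =
        (\<Sum>p\<in>{id}. of_int (sign p) *
          (\<Sum>i\<in>UNIV. H $ i $ p i * (\<Prod>j\<in>UNIV - {i}. ?M $ j $ p j)))"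
      by (rule sum.mono_neutral_right) (auto simp: zero permutes_id)
    also have "\<dots> = trace H" by (simp add: trace_def mat_def)
    finally show ?thesis .
  qed
  ultimately show ?thesis by simp
qed

lemma Qfun_has_derivative:
  fixes L :: "real ^ 'n ^ 'n"
  assumes X: "X \<in> psd_polys L" and pos: "0 < det (mat 1 + c *\<^sub>R (X ** L))"
  shows "(Qfun c L has_derivative (\<lambda>H. trace (Qderiv c L X ** H))) (at X)"
proof -
  define M where "M = mat 1 + c *\<^sub>R (X ** L)"
  define d where "d = det M"
  define J where "J = matrix_inv M"
  have d: "0 < d" using pos by (simp add: d_def M_def)
  have "invertible M" using d by (simp add: d_def invertible_det_nz)
  then have MJ: "M ** J = mat 1" "J ** M = mat 1"
    unfolding J_def matrix_inv_def invertible_def by (metis (mono_tags, lifting) someI_ex)+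
  have "X ** L = L ** X" using X by (auto simp: psd_polys_def matpoly_commute)
  then have "X ** L ** L = L ** (X ** L)" by (metis matrix_mul_assoc)
  then have comm: "M ** L = L ** M"
    by (simp add: M_def matrix_add_ldistrib matrix_add_mult_right scaleR_matrix_mult_left
        scaleR_matrix_mult_right)
  have JL: "L ** J = J ** L"
    by (metis comm MJ matrix_mul_assoc matrix_mul_lid matrix_mul_rid)
  have lin: "bounded_linear (\<lambda>Y. c *\<^sub>R (J ** (Y ** L)))"
    by (intro linear_conv_bounded_linear[THEN iffD1] linearI)
      (simp_all add: matrix_add_ldistrib matrix_add_mult_right scaleR_matrix_mult_left
        scaleR_matrix_mult_right scaleR_right_distrib)
  have "((\<lambda>Y. J + c *\<^sub>R (J ** (Y ** L))) has_derivative (\<lambda>H. c *\<^sub>R (J ** (H ** L)))) (at X)"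
    using has_derivative_add[OF has_derivative_const bounded_linear_imp_has_derivative[OF lin]] by simp
  moreover have "J + c *\<^sub>R (J ** (X ** L)) = mat 1"
    using MJ(2) by (simp add: M_def matrix_add_ldistrib scaleR_matrix_mult_right)
  ultimately have "((\<lambda>Y. det (J + c *\<^sub>R (J ** (Y ** L)))) has_derivative
      (\<lambda>H. trace (c *\<^sub>R (J ** (H ** L))))) (at X)"
    using has_derivative_compose[of "\<lambda>Y. J + c *\<^sub>R (J ** (Y ** L))" _ X UNIV det]
      det_has_derivative_mat_1 by simp
  moreover have "det (mat 1 + c *\<^sub>R (Y ** L)) = d * det (J + c *\<^sub>R (J ** (Y ** L)))" for Y
  proof -
    have "M ** (J + c *\<^sub>R (J ** (Y ** L))) = mat 1 + c *\<^sub>R (Y ** L)"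
      using MJ(1) by (simp add: matrix_add_ldistrib scaleR_matrix_mult_right matrix_mul_assoc)
    then show ?thesis unfolding d_def by (metis det_mul)
  qed
  ultimately have det': "((\<lambda>Y. det (mat 1 + c *\<^sub>R (Y ** L))) has_derivative
      (\<lambda>H. d * trace (c *\<^sub>R (J ** (H ** L))))) (at X)"
    by (simp add: has_derivative_mult_right)
  have N: "0 < CARD('n)" by simp
  have "DERIV (root CARD('n)) d :> inverse (real CARD('n) * root CARD('n) d ^ (CARD('n) - Suc 0))"
    by (rule DERIV_real_root[OF N d])
  also have "inverse (real CARD('n) * root CARD('n) d ^ (CARD('n) - Suc 0)) =
      root CARD('n) d / (real CARD('n) * d)"
  proof -
    define r where "r = root CARD('n) d"
    have r: "0 < r" "r ^ CARD('n) = d" using d N by (simp_all add: r_def)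
    then have "d = r * r ^ (CARD('n) - Suc 0)" by (metis N Suc_pred power_Suc)
    then show ?thesis unfolding r_def[symmetric] using r(1) d by (simp add: field_simps)
  qed
  finally have "(root CARD('n) has_derivative (*) (root CARD('n) d / (real CARD('n) * d))) (at d)"
    by (simp add: has_field_derivative_def)
  then have "(Qfun c L has_derivative
      (\<lambda>H. root CARD('n) d / (real CARD('n) * d) * (d * trace (c *\<^sub>R (J ** (H ** L)))))) (at X)"
    unfolding Qfun_def[abs_def]
    by (intro has_derivative_compose[OF det', of "root CARD('n)"]) (simp only: d_def M_def)
  moreover have "root CARD('n) d / (real CARD('n) * d) * (d * trace (c *\<^sub>R (J ** (H ** L)))) =
      trace (Qderiv c L X ** H)" for H
  proof -
    have sc: "trace (r *\<^sub>R A) = r * trace A" for r and A :: "real^'n^'n"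
      by (simp add: trace_def sum_distrib_left)
    have "trace (J ** (H ** L)) = trace (L ** (J ** H))"
      by (subst trace_mul_sym[symmetric]) (simp add: matrix_mul_assoc)
    also have "\<dots> = trace (J ** L ** H)" by (simp add: matrix_mul_assoc JL)
    finally show ?thesis
      using d by (simp add: Qderiv_def Qfun_def M_def[symmetric] d_def[symmetric] J_def[symmetric]
          sc scaleR_matrix_mult_left scaleR_matrix_mult_right)
  qed
  ultimately show ?thesis by simp
qed

end

theory Submission
  imports Defs
begin

text \<open>Every matrix in the problem is a function of \<open>L\<close>, so everything happens in one orthonormal
  eigenbasis of \<open>L\<close>. Let \<open>L = U diag(\<lambda>) U\<^sup>T\<close> with \<open>U\<close> orthogonal; the eigenvalues
  \<open>\<lambda>\<^sub>i\<close> are nonnegative. A matrix is a positive semidefinite polynomial of \<open>L\<close>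
  exactly when it equals \<open>U diag(x) U\<^sup>T\<close> with \<open>x \<ge> 0\<close> and \<open>x\<^sub>i = x\<^sub>j\<close> whenever
  \<open>\<lambda>\<^sub>i = \<lambda>\<^sub>j\<close> (\<open>psd_polys_conj_diag_iff\<close>). With \<open>k = a + q\<close> and
  \<open>e\<^sub>i(t) = exp (- t k \<lambda>\<^sub>i)\<close>, the matrix equation therefore becomes the system
  \<open>r\<^sub>i' = g(t, r) e\<^sub>i(t)\<close>, \<open>r(0) = 0\<close>, where
  \<open>g(t, r) = (1/N) (\<Prod>\<^sub>j (1 + c \<lambda>\<^sub>j r\<^sub>j))\<^bsup>1/N\<^esup>
     \<Sum>\<^sub>j \<lambda>\<^sub>j e\<^sub>j(t) / (1 + c \<lambda>\<^sub>j r\<^sub>j)\<close>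
  (\<open>ode_solution_conj_diag_iff\<close>). Components that belong to equal eigenvalues satisfy the
  same equation, so the constraint on equal eigenvalues is preserved automatically.

  On every box \<open>[0, M]\<^sup>N\<close> all factors \<open>1 + c \<lambda>\<^sub>j r\<^sub>j\<close> are at least \<open>1\<close>, so \<open>g\<close> is
  Lipschitz in \<open>r\<close>, uniformly in \<open>t\<close> (\<open>eig_rate_lipschitz\<close>). Solutions are continuous on
  \<open>[0, T]\<close> and hence stay in some box; uniqueness follows from Gronwall's inequality.

  For existence, \<open>g\<close> need not be Lipschitz on the whole orthant, so \<open>r\<close> is truncated to \<open>[0, M]\<^sup>N\<close> inside \<open>g\<close>.
  The truncated equation is solved by the Banach fixed point theorem
  (\<open>lipschitz_ode_exists\<close>). Its solution has nonnegative components because \<open>g \<ge> 0\<close>. Each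
  factor under the root is at most \<open>1 + c \<Lambda> \<Sum>\<^sub>i r\<^sub>i\<close> with \<open>\<Lambda> = \<Sum>\<^sub>i \<lambda>\<^sub>i\<close>, so the
  geometric mean, and with it \<open>g\<close>, grows at most linearly in \<open>\<Sum>\<^sub>i r\<^sub>i\<close> (\<open>eig_rate_le\<close>).
  Gronwall's inequality then bounds \<open>\<Sum>\<^sub>i r\<^sub>i\<close> by an exponential in \<open>T\<close>, independently of \<open>M\<close>;
  for \<open>M\<close> equal to this bound the truncation is never active.\<close>

section \<open>Orthogonal diagonalization of symmetric matrices\<close>

text \<open>A maximizer \<open>v\<close> of the quadratic form \<open>x \<bullet> f x\<close> on the unit sphere of \<open>V\<close>, with maximum \<open>\<mu>\<close>,
  is an eigenvector: \<open>\<mu> (x \<bullet> x) - x \<bullet> f x\<close> is nonnegative on \<open>V\<close> and vanishes at \<open>v\<close>, so it is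
  stationary there, and its derivative at \<open>v\<close> in the direction \<open>w = \<mu> v - f v\<close> is \<open>2 (w \<bullet> w)\<close>.\<close>

lemma self_adjoint_unit_eigenvector:
  fixes f :: "'a::euclidean_space \<Rightarrow> 'a"
  assumes f: "linear f" and sym: "\<And>x y. x \<bullet> f y = f x \<bullet> y"
    and V: "subspace V" "\<And>x. x \<in> V \<Longrightarrow> f x \<in> V" "V \<noteq> {0}"
  obtains v \<mu> where "v \<in> V" "norm v = 1" "f v = \<mu> *\<^sub>R v"
proof -
  let ?K = "V \<inter> sphere 0 1"
  obtain z where "z \<in> V" "z \<noteq> 0" using V(1,3) subspace_0 by blast
  then have "(1 / norm z) *\<^sub>R z \<in> ?K" using V(1) by (simp add: subspace_scale)
  then have "?K \<noteq> {}" by blast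
  moreover have "compact ?K" using closed_subspace[OF V(1)] by (simp add: closed_Int_compact)
  moreover have "continuous_on ?K (\<lambda>x. x \<bullet> f x)"
    using f by (intro continuous_intros linear_continuous_on) (simp add: linear_conv_bounded_linear)
  ultimately obtain v where v: "v \<in> ?K" and max: "\<And>y. y \<in> ?K \<Longrightarrow> y \<bullet> f y \<le> v \<bullet> f v"
    using continuous_attains_sup by (metis (no_types, lifting))
  define \<mu> where "\<mu> = v \<bullet> f v"
  have le: "y \<bullet> f y \<le> \<mu> * (y \<bullet> y)" if y: "y \<in> V" for y
  proof (cases "y = 0")
    case False
    have "(1 / norm y) *\<^sub>R y \<in> ?K" using y False V(1) by (simp add: subspace_scale)
    from max[OF this] have "(1 / norm y)\<^sup>2 * (y \<bullet> f y) \<le> \<mu>"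
      by (simp add: \<mu>_def linear_scale[OF f] power2_eq_square)
    then show ?thesis using False
      by (simp add: power_divide divide_simps dot_square_norm)
  qed (simp add: linear_0[OF f])
  define w where "w = \<mu> *\<^sub>R v - f v"
  have w: "w \<in> V" using v V by (simp add: w_def subspace_diff subspace_scale)
  have vv: "v \<bullet> v = 1" using v by (simp add: dot_square_norm)
  \<comment> \<open>The form at \<open>v + t w\<close>, expanded in powers of \<open>t\<close>: the constant term vanishes.\<close>
  have q: "0 \<le> 2 * t * (w \<bullet> w) + t\<^sup>2 * (\<mu> * (w \<bullet> w) - w \<bullet> f w)" for t
  proof -
    have "v + t *\<^sub>R w \<in> V" using v w V(1) by (simp add: subspace_add subspace_scale)
    then have "0 \<le> \<mu> * ((v + t *\<^sub>R w) \<bullet> (v + t *\<^sub>R w)) - (v + t *\<^sub>R w) \<bullet> f (v + t *\<^sub>R w)"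
      using le by (metis diff_ge_0_iff_ge)
    also have "\<dots> = \<mu> * (1 + 2 * t * (v \<bullet> w) + t\<^sup>2 * (w \<bullet> w))
        - (\<mu> + 2 * t * (f v \<bullet> w) + t\<^sup>2 * (w \<bullet> f w))"
      using sym[of v w]
      by (simp add: linear_add[OF f] linear_scale[OF f] inner_add_left inner_add_right vv \<mu>_def
          inner_commute algebra_simps power2_eq_square)
    also have "\<dots> = 2 * t * (w \<bullet> w) + t\<^sup>2 * (\<mu> * (w \<bullet> w) - w \<bullet> f w)"
    proof -
      have "w \<bullet> w = \<mu> * (v \<bullet> w) - f v \<bullet> w"
        by (metis w_def inner_diff_left inner_scaleR_left)
      then show ?thesis by algebra
    qed
    finally show ?thesis .
  qed
  define C where "C = \<mu> * (w \<bullet> w) - w \<bullet> f w"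
  define D where "D = w \<bullet> w"
  have C0: "0 \<le> C" using le[OF w] by (simp add: C_def)
  have "D = 0"
  proof (rule ccontr)
    assume "D \<noteq> 0"
    then have D: "0 < D" by (simp add: D_def)
    \<comment> \<open>If \<open>D > 0\<close>, a small negative \<open>t\<close> makes the linear term win; \<open>C + 1\<close> avoids a division by zero.\<close>
    have "0 \<le> 2 * (- D / (C + 1)) * D + (- D / (C + 1))\<^sup>2 * C"
      using q[of "- D / (C + 1)"] by (simp add: C_def D_def)
    also have "\<dots> = D\<^sup>2 * (C / (C + 1) - 2) / (C + 1)"
      using C0 by (simp add: power2_eq_square divide_simps) (simp add: algebra_simps)
    also have "\<dots> < 0"
      using D C0 by (intro divide_neg_pos mult_pos_neg) (auto simp: divide_simps)
    finally show False by simp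
  qed
  then have "f v = \<mu> *\<^sub>R v" by (simp add: D_def w_def)
  then show ?thesis using that v by auto
qed

text \<open>The orthogonal complement in \<open>V\<close> of an eigenvector is again invariant under \<open>f\<close>, which gives
  an induction on the dimension of \<open>V\<close>.\<close>

lemma self_adjoint_orthonormal_eigenbasis:
  fixes f :: "'a::euclidean_space \<Rightarrow> 'a"
  assumes f: "linear f" and sym: "\<And>x y. x \<bullet> f y = f x \<bullet> y"
    and V: "subspace V" "\<And>x. x \<in> V \<Longrightarrow> f x \<in> V"
  shows "\<exists>B \<subseteq> V. finite B \<and> card B = dim V \<and> pairwise orthogonal B \<and>
           (\<forall>v\<in>B. norm v = 1 \<and> (\<exists>\<mu>. f v = \<mu> *\<^sub>R v))"
  using V
proof (induction "dim V" arbitrary: V)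
  case 0
  then show ?case by (intro exI[of _ "{}"]) auto
next
  case (Suc n)
  have "V \<noteq> {0}" using Suc.hyps(2) by auto
  then obtain v \<mu> where v: "v \<in> V" "norm v = 1" "f v = \<mu> *\<^sub>R v"
    using self_adjoint_unit_eigenvector[OF f sym Suc.prems] by metis
  define W where "W = {y \<in> V. orthogonal v y}"
  have W: "subspace W"
    using subspace_inter[OF Suc.prems(1) subspace_orthogonal_to_vector[of v]]
    by (simp add: W_def Collect_conj_eq)
  have fW: "f y \<in> W" if "y \<in> W" for y
  proof -
    have "v \<bullet> f y = \<mu> * (v \<bullet> y)" by (simp add: sym v(3))
    then show ?thesis using that Suc.prems(2) by (simp add: W_def orthogonal_def)
  qed
  have "dim W + dim {v} = dim V"
  proof -
    have "dim {y \<in> V. \<forall>x\<in>span {v}. orthogonal x y} + dim (span {v}) = dim V"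
      using Suc.prems(1) v(1) by (intro dim_subspace_orthogonal_to_vectors) (auto simp: span_minimal)
    moreover have "{y \<in> V. \<forall>x\<in>span {v}. orthogonal x y} = W"
      by (auto simp: W_def span_singleton orthogonal_def)
    ultimately show ?thesis by simp
  qed
  moreover have "v \<noteq> 0" using v(2) by auto
  ultimately have dW: "n = dim W" using Suc.hyps(2) by simp
  from Suc.hyps(1)[OF dW W fW] obtain B where B: "B \<subseteq> W" "finite B" "card B = dim W"
    "pairwise orthogonal B" "\<forall>v\<in>B. norm v = 1 \<and> (\<exists>\<mu>. f v = \<mu> *\<^sub>R v)" by blast
  have "v \<notin> B" using B(1) v(2) by (auto simp: W_def orthogonal_def dot_square_norm)
  moreover have "orthogonal v y" "orthogonal y v" if "y \<in> B" for y
    using that B(1) by (auto simp: W_def orthogonal_commute)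
  ultimately show ?case
    using B v Suc.hyps(2) dW
    by (intro exI[of _ "insert v B"]) (auto simp: pairwise_insert W_def)
qed

definition diag_matrix :: "real ^ 'n \<Rightarrow> real ^ 'n ^ 'n" where
  "diag_matrix x = (\<chi> i j. if i = j then x $ i else 0)"

definition conj_diag :: "real ^ 'n ^ 'n \<Rightarrow> real ^ 'n \<Rightarrow> real ^ 'n ^ 'n" where
  "conj_diag U x = U ** diag_matrix x ** transpose U"

lemma matrix_mult_diag: "(A ** diag_matrix x) $ i $ j = A $ i $ j * x $ j"
proof -
  have "(A ** diag_matrix x) $ i $ j = (\<Sum>k\<in>UNIV. if k = j then A $ i $ j * x $ j else 0)"
    by (simp add: matrix_matrix_mult_def diag_matrix_def if_distrib cong: if_cong)
  then show ?thesis by simp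
qed

theorem symmetric_matrix_conj_diag:
  fixes A :: "real ^ 'n ^ 'n"
  assumes "transpose A = A"
  obtains U lam where "orthogonal_matrix U" "A = conj_diag U lam"
proof -
  have "\<exists>B \<subseteq> UNIV. finite B \<and> card B = dim (UNIV :: (real^'n) set) \<and> pairwise orthogonal B \<and>
           (\<forall>v\<in>B. norm v = 1 \<and> (\<exists>\<mu>. A *v v = \<mu> *\<^sub>R v))"
  proof (intro self_adjoint_orthonormal_eigenbasis)
    show "x \<bullet> (A *v y) = (A *v x) \<bullet> y" for x y
      using assms by (metis dot_lmul_matrix transpose_matrix_vector)
  qed (auto simp: matrix_vector_mul_linear subspace_UNIV)
  then obtain B where B: "finite B" "card B = CARD('n)" "pairwise orthogonal B"
    "\<forall>v\<in>B. norm v = 1 \<and> (\<exists>\<mu>. A *v v = \<mu> *\<^sub>R v)" by (auto simp: dim_UNIV)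
  obtain b where b: "bij_betw b (UNIV :: 'n set) B"
    using B(1,2) finite_same_card_bij by (metis finite_class.finite_UNIV)
  have "\<exists>lam. \<forall>i. A *v b i = lam i *\<^sub>R b i"
    using B(4) b by (intro choice) (metis UNIV_I bij_betwE)
  then obtain lam where lam: "\<And>i. A *v b i = lam i *\<^sub>R b i" by blast
  define U where "U = (\<chi> i j. b j $ i)"
  have col: "column j U = b j" for j by (simp add: U_def column_def)
  have U: "orthogonal_matrix U"
    unfolding orthogonal_matrix_orthonormal_columns col
    using B(3,4) b by (metis UNIV_I bij_betw_def bij_betwE inj_onD pairwiseD)
  have "(A ** U) $ i $ j = (A *v b j) $ i" for i j
    by (simp add: matrix_matrix_mult_def matrix_vector_mult_def U_def)
  then have "A ** U = U ** diag_matrix (\<chi> i. lam i)"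
    by (simp add: vec_eq_iff lam matrix_mult_diag) (simp add: U_def mult.commute)
  then have "A = conj_diag U (\<chi> i. lam i)"
    using U unfolding conj_diag_def orthogonal_matrix_def
    by (metis matrix_mul_assoc matrix_mul_rid)
  then show ?thesis using that U by blast
qed

section \<open>Matrix functions in an orthonormal eigenbasis\<close>

lemma conj_diag_add: "conj_diag U (x + y) = conj_diag U x + conj_diag U y"
proof -
  have "diag_matrix (x + y) = diag_matrix x + diag_matrix y"
    by (simp add: diag_matrix_def vec_eq_iff)
  then show ?thesis by (simp add: conj_diag_def matrix_add_ldistrib matrix_add_mult_right)
qed

lemma conj_diag_scaleR: "conj_diag U (r *\<^sub>R x) = r *\<^sub>R conj_diag U x"
proof -
  have "diag_matrix (r *\<^sub>R x) = r *\<^sub>R diag_matrix x"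
    by (simp add: diag_matrix_def vec_eq_iff)
  then show ?thesis
    by (simp add: conj_diag_def scaleR_matrix_mult_left scaleR_matrix_mult_right)
qed

lemma bounded_linear_conj_diag: "bounded_linear (conj_diag U)"
  by (intro linear_conv_bounded_linear[THEN iffD1] linearI conj_diag_add conj_diag_scaleR)

text \<open>The diagonal of \<open>U\<^sup>T X U\<close>. It inverts \<open>conj_diag U\<close> and is linear in \<open>X\<close>, so it carries derivatives
  of matrix paths to derivatives of eigenvalues.\<close>

definition diag_coords :: "real ^ 'n ^ 'n \<Rightarrow> real ^ 'n ^ 'n \<Rightarrow> real ^ 'n" where
  "diag_coords U X = (\<chi> i. (transpose U ** X ** U) $ i $ i)"

lemma bounded_linear_diag_coords: "bounded_linear (diag_coords U)"
  by (intro linear_conv_bounded_linear[THEN iffD1] linearI)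
    (simp_all add: diag_coords_def vec_eq_iff matrix_add_ldistrib matrix_add_mult_right
      scaleR_matrix_mult_left scaleR_matrix_mult_right)

lemma transpose_conj_diag: "transpose (conj_diag U x) = conj_diag U x"
proof -
  have "transpose (diag_matrix x) = diag_matrix x"
    by (auto simp: diag_matrix_def transpose_def vec_eq_iff)
  then show ?thesis by (simp add: conj_diag_def matrix_transpose_mul matrix_mul_assoc)
qed

context
  fixes U :: "real ^ 'n ^ 'n"
  assumes U: "orthogonal_matrix U"
begin

lemma diag_coords_conj_diag: "diag_coords U (conj_diag U x) = x"
proof -
  have "transpose U ** conj_diag U x ** U = (transpose U ** U) ** diag_matrix x ** (transpose U ** U)"
    by (simp add: conj_diag_def matrix_mul_assoc)
  also have "\<dots> = diag_matrix x" using U by (simp add: orthogonal_matrix_def)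
  finally show ?thesis by (simp add: diag_coords_def diag_matrix_def vec_eq_iff)
qed

lemma conj_diag_1: "conj_diag U 1 = mat 1"
proof -
  have "diag_matrix (1 :: real ^ 'n) = mat 1"
    by (simp add: diag_matrix_def mat_def vec_eq_iff)
  then show ?thesis using U by (simp add: conj_diag_def orthogonal_matrix_def)
qed

text \<open>Multiplication on \<open>real ^ 'n\<close> is componentwise, so \<open>conj_diag U\<close> is a homomorphism from
  \<open>real ^ 'n\<close> to the matrix ring.\<close>

lemma conj_diag_mult: "conj_diag U x ** conj_diag U y = conj_diag U (x * y)"
proof -
  have "conj_diag U x ** conj_diag U y =
      U ** diag_matrix x ** (transpose U ** U) ** diag_matrix y ** transpose U"
    by (simp add: conj_diag_def matrix_mul_assoc)
  also have "\<dots> = U ** (diag_matrix x ** diag_matrix y) ** transpose U"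
    using U by (simp add: orthogonal_matrix_def matrix_mul_assoc)
  also have "diag_matrix x ** diag_matrix y = diag_matrix (x * y)"
    by (simp add: vec_eq_iff matrix_mult_diag) (simp add: diag_matrix_def)
  finally show ?thesis by (simp add: conj_diag_def)
qed

lemma det_conj_diag: "det (conj_diag U x) = (\<Prod>i\<in>UNIV. x $ i)"
proof -
  have "det (conj_diag U x) = det (transpose U ** U) * det (diag_matrix x)"
    by (simp add: conj_diag_def det_mul)
  then show ?thesis using U
    by (simp add: orthogonal_matrix_def) (subst det_diagonal, auto simp: diag_matrix_def)
qed

lemma trace_conj_diag: "trace (conj_diag U x) = (\<Sum>i\<in>UNIV. x $ i)"
proof -
  have "trace (conj_diag U x) = trace (transpose U ** U ** diag_matrix x)"
    unfolding conj_diag_def by (metis trace_mul_sym matrix_mul_assoc)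
  then show ?thesis using U by (simp add: orthogonal_matrix_def trace_def diag_matrix_def)
qed

lemma matrix_inv_conj_diag:
  assumes "\<And>i. x $ i \<noteq> 0"
  shows "matrix_inv (conj_diag U x) = conj_diag U (\<chi> i. 1 / x $ i)"
proof -
  let ?y = "\<chi> i. 1 / x $ i"
  have "x * ?y = 1" "?y * x = 1" using assms by (simp_all add: vec_eq_iff)
  then have *: "conj_diag U x ** conj_diag U ?y = mat 1" "conj_diag U ?y ** conj_diag U x = mat 1"
    by (simp_all add: conj_diag_mult conj_diag_1)
  then have "conj_diag U x ** matrix_inv (conj_diag U x) = mat 1"
    unfolding matrix_inv_def by (metis (mono_tags, lifting) someI_ex)
  then show ?thesis using * by (metis matrix_mul_assoc matrix_mul_lid matrix_mul_rid)
qed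

lemma matpow_conj_diag: "matpow (conj_diag U x) k = conj_diag U (\<chi> i. x $ i ^ k)"
proof (induction k)
  case 0
  have "(\<chi> i. x $ i ^ 0) = 1" by (simp add: vec_eq_iff)
  then show ?case by (simp add: conj_diag_1)
next
  case (Suc k)
  have "x * (\<chi> i. x $ i ^ k) = (\<chi> i. x $ i ^ Suc k)" by (simp add: vec_eq_iff)
  then show ?case by (simp only: matpow.simps Suc conj_diag_mult)
qed

lemma matpoly_conj_diag: "matpoly p (conj_diag U x) = conj_diag U (\<chi> i. poly p (x $ i))"
proof -
  have "matpoly p (conj_diag U x) =
      conj_diag U (\<Sum>k\<le>degree p. coeff p k *\<^sub>R (\<chi> i. x $ i ^ k))"
    by (simp add: matpoly_def matpow_conj_diag linear_sum[OF bounded_linear.linear[OF bounded_linear_conj_diag]]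
        conj_diag_scaleR)
  also have "(\<Sum>k\<le>degree p. coeff p k *\<^sub>R (\<chi> i. x $ i ^ k)) = (\<chi> i. poly p (x $ i))"
    by (simp add: vec_eq_iff poly_altdef)
  finally show ?thesis .
qed

lemma matexp_conj_diag: "matexp (conj_diag U x) = conj_diag U (\<chi> i. exp (x $ i))"
proof -
  have "(\<lambda>k. ((1 / fact k) *\<^sub>R (\<chi> i. x $ i ^ k) :: real ^ 'n)) sums (\<chi> i. exp (x $ i))"
    unfolding sums_def
  proof (rule vec_tendstoI)
    fix i
    show "(\<lambda>n. (\<Sum>k<n. (1 / fact k) *\<^sub>R (\<chi> i. x $ i ^ k) :: real ^ 'n) $ i)
        \<longlonglongrightarrow> (\<chi> i. exp (x $ i)) $ i"
      using exp_converges[of "x $ i"] by (simp add: sums_def divide_inverse)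
  qed
  then have "(\<lambda>k. conj_diag U ((1 / fact k) *\<^sub>R (\<chi> i. x $ i ^ k))) sums conj_diag U (\<chi> i. exp (x $ i))"
    by (rule bounded_linear.sums[OF bounded_linear_conj_diag])
  then have "(\<lambda>k. (1 / fact k) *\<^sub>R matpow (conj_diag U x) k) sums conj_diag U (\<chi> i. exp (x $ i))"
    by (simp only: conj_diag_scaleR matpow_conj_diag)
  then show ?thesis using matexp_sums sums_unique2 by blast
qed

lemma pos_semidef_conj_diag: "pos_semidef (conj_diag U x) \<longleftrightarrow> (\<forall>i. 0 \<le> x $ i)"
proof -
  have quad: "v \<bullet> (conj_diag U x *v v) = (\<Sum>i\<in>UNIV. x $ i * ((transpose U *v v) $ i)\<^sup>2)" for v
  proof -
    let ?w = "transpose U *v v"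
    have "v \<bullet> (conj_diag U x *v v) = ?w \<bullet> (diag_matrix x *v ?w)"
      by (simp add: conj_diag_def dot_lmul_matrix flip: matrix_vector_mul_assoc)
    also have "diag_matrix x *v ?w = (\<chi> i. x $ i * ?w $ i)"
    proof -
      have "(diag_matrix x *v ?w) $ i = (\<Sum>j\<in>UNIV. if j = i then x $ i * ?w $ i else 0)" for i
        unfolding diag_matrix_def matrix_vector_mult_def vec_lambda_beta by (intro sum.cong) auto
      then show ?thesis by (simp add: vec_eq_iff)
    qed
    finally show ?thesis by (simp add: inner_vec_def power2_eq_square mult_ac)
  qed
  show ?thesis
  proof
    assume psd: "pos_semidef (conj_diag U x)"
    show "\<forall>i. 0 \<le> x $ i"
    proof
      fix i
      have "transpose U *v (U *v axis i 1) = axis i 1"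
        using U by (simp add: orthogonal_matrix_def matrix_vector_mul_assoc del: transpose_matrix_vector)
      moreover have "0 \<le> (U *v axis i 1) \<bullet> (conj_diag U x *v (U *v axis i 1))"
        using psd unfolding pos_semidef_def by blast
      ultimately have "0 \<le> (\<Sum>j\<in>UNIV. x $ j * (axis i (1::real) $ j)\<^sup>2)"
        unfolding quad by (simp only:)
      moreover have "(\<Sum>j\<in>UNIV. x $ j * (axis i (1::real) $ j)\<^sup>2) = (\<Sum>j\<in>UNIV. if j = i then x $ j else 0)"
        by (intro sum.cong) (auto simp: axis_def)
      ultimately show "0 \<le> x $ i" by simp
    qed
  next
    assume "\<forall>i. 0 \<le> x $ i"
    then show "pos_semidef (conj_diag U x)"
      unfolding pos_semidef_def quad by (auto simp: transpose_conj_diag intro!: sum_nonneg)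
  qed
qed

end

text \<open>Newton interpolation: a correction by a multiple of \<open>\<Prod>s\<in>S. (X - s)\<close> fixes the value at a new
  node without changing the values at the nodes in \<open>S\<close>.\<close>

lemma poly_interpolation:
  fixes f :: "'a::field \<Rightarrow> 'a"
  assumes "finite S"
  shows "\<exists>p. \<forall>x\<in>S. poly p x = f x"
  using assms
proof (induction S)
  case (insert a S)
  then obtain p where p: "\<forall>x\<in>S. poly p x = f x" by blast
  define w where "w = (\<Prod>s\<in>S. [:- s, 1:])"
  have "poly w a \<noteq> 0" "\<forall>x\<in>S. poly w x = 0"
    using insert.hyps by (auto simp: w_def poly_prod)
  then show ?case
    using p by (intro exI[of _ "p + smult ((f a - poly p a) / poly w a) w"]) auto
qed auto

text \<open>A polynomial of \<open>L\<close> sees only the eigenvalue, not the index, so it assigns equal values to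
  equal eigenvalues. Conversely, interpolation on the finite spectrum realizes every function of
  the eigenvalue.\<close>

lemma psd_polys_conj_diag_iff:
  assumes "orthogonal_matrix U"
  shows "X \<in> psd_polys (conj_diag U lam) \<longleftrightarrow>
    (\<exists>x. X = conj_diag U x \<and> (\<forall>i. 0 \<le> x $ i) \<and> (\<forall>i j. lam $ i = lam $ j \<longrightarrow> x $ i = x $ j))"
proof
  assume "X \<in> psd_polys (conj_diag U lam)"
  then show "\<exists>x. X = conj_diag U x \<and> (\<forall>i. 0 \<le> x $ i) \<and> (\<forall>i j. lam $ i = lam $ j \<longrightarrow> x $ i = x $ j)"
    using assms by (auto simp: psd_polys_def matpoly_conj_diag pos_semidef_conj_diag)
next
  assume "\<exists>x. X = conj_diag U x \<and> (\<forall>i. 0 \<le> x $ i) \<and> (\<forall>i j. lam $ i = lam $ j \<longrightarrow> x $ i = x $ j)"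
  then obtain x where x: "X = conj_diag U x" "\<forall>i. 0 \<le> x $ i"
    "\<And>i j. lam $ i = lam $ j \<Longrightarrow> x $ i = x $ j" by blast
  \<comment> \<open>Any index with eigenvalue \<open>l\<close> serves, by the third property of \<open>x\<close>.\<close>
  obtain p where p: "\<forall>l\<in>range (($) lam). poly p l = x $ (SOME i. lam $ i = l)"
    using poly_interpolation[of "range (($) lam)" "\<lambda>l. x $ (SOME i. lam $ i = l)"] by auto
  have "poly p (lam $ i) = x $ i" for i
  proof -
    have "lam $ (SOME j. lam $ j = lam $ i) = lam $ i" by (rule someI) simp
    then have "x $ (SOME j. lam $ j = lam $ i) = x $ i" by (rule x(3))
    then show ?thesis using bspec[OF p, of "lam $ i"] by simp
  qed
  then have "X = matpoly p (conj_diag U lam)"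
    using assms x(1) by (simp add: matpoly_conj_diag)
  moreover have "pos_semidef X"
    using x(2) unfolding x(1) pos_semidef_conj_diag[OF assms] .
  ultimately show "X \<in> psd_polys (conj_diag U lam)"
    unfolding psd_polys_def by blast
qed

section \<open>Positivity of the normalized Laplacian\<close>

text \<open>Each edge term is controlled by the inequality
  \<open>x\<^sub>i x\<^sub>j / sqrt (d\<^sub>i d\<^sub>j) \<le> (x\<^sub>i\<^sup>2 / d\<^sub>i + x\<^sub>j\<^sup>2 / d\<^sub>j) / 2\<close>; summed over all neighbours,
  \<open>x\<^sub>i\<^sup>2 / d\<^sub>i\<close> contributes at most \<open>x\<^sub>i\<^sup>2\<close> (and \<open>0\<close> at an isolated vertex).\<close>

lemma pos_semidef_norm_laplacian:
  assumes "simple_graph adj"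
  shows "pos_semidef (norm_laplacian adj)"
proof -
  interpret simple_graph adj by fact
  let ?d = "\<lambda>i. real (degree_of adj i)"
  have "transpose (norm_laplacian adj) = norm_laplacian adj"
    using adj_sym by (auto simp: norm_laplacian_def transpose_def vec_eq_iff mult.commute)
  moreover have "0 \<le> x \<bullet> (norm_laplacian adj *v x)" for x
  proof -
    let ?e = "\<lambda>i j. if adj i j then x $ i * x $ j / sqrt (?d i * ?d j) else 0"
    let ?h = "\<lambda>i j. if adj i j then (x $ i)\<^sup>2 / ?d i else 0"
    have "x \<bullet> (norm_laplacian adj *v x) = (\<Sum>i\<in>UNIV. \<Sum>j\<in>UNIV. x $ i * (norm_laplacian adj $ i $ j * x $ j))"
      by (simp add: inner_vec_def matrix_vector_mult_def sum_distrib_left)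
    also have "\<dots> = (\<Sum>i\<in>UNIV. \<Sum>j\<in>UNIV. (if i = j then (x $ i)\<^sup>2 else 0) - ?e i j)"
      using adj_irrefl by (intro sum.cong refl) (auto simp: norm_laplacian_def power2_eq_square)
    also have "\<dots> = (\<Sum>i\<in>UNIV. (x $ i)\<^sup>2) - (\<Sum>i\<in>UNIV. \<Sum>j\<in>UNIV. ?e i j)"
      by (simp add: sum_subtractf)
    finally have eq: "x \<bullet> (norm_laplacian adj *v x) =
        (\<Sum>i\<in>UNIV. (x $ i)\<^sup>2) - (\<Sum>i\<in>UNIV. \<Sum>j\<in>UNIV. ?e i j)" .
    have "?e i j \<le> (?h i j + ?h j i) / 2" for i j
    proof (cases "adj i j")
      case True
      have "0 \<le> (x $ i / sqrt (?d i) - x $ j / sqrt (?d j))\<^sup>2" by simp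
      also have "\<dots> = (x $ i)\<^sup>2 / ?d i + (x $ j)\<^sup>2 / ?d j - 2 * (x $ i * x $ j / sqrt (?d i * ?d j))"
        by (simp add: power2_diff power_divide real_sqrt_mult)
      finally show ?thesis using True adj_sym by (simp add: mult.commute)
    qed (use adj_sym in auto)
    then have "(\<Sum>i\<in>UNIV. \<Sum>j\<in>UNIV. ?e i j) \<le> (\<Sum>i\<in>UNIV. \<Sum>j\<in>UNIV. (?h i j + ?h j i) / 2)"
      by (intro sum_mono)
    also have "\<dots> = ((\<Sum>i\<in>UNIV. \<Sum>j\<in>UNIV. ?h i j) + (\<Sum>i\<in>UNIV. \<Sum>j\<in>UNIV. ?h j i)) / 2"
      by (simp add: sum.distrib flip: sum_divide_distrib)
    also have "(\<Sum>i\<in>UNIV. \<Sum>j\<in>UNIV. ?h j i) = (\<Sum>i\<in>UNIV. \<Sum>j\<in>UNIV. ?h i j)"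
      by (rule sum.swap)
    finally have "(\<Sum>i\<in>UNIV. \<Sum>j\<in>UNIV. ?e i j) \<le> (\<Sum>i\<in>UNIV. \<Sum>j\<in>UNIV. ?h i j)" by simp
    also have "\<dots> \<le> (\<Sum>i\<in>UNIV. (x $ i)\<^sup>2)"
    proof (rule sum_mono)
      fix i
      have "(\<Sum>j\<in>UNIV. ?h i j) = ?d i * ((x $ i)\<^sup>2 / ?d i)"
        by (simp add: degree_of_def flip: sum.inter_filter)
      also have "\<dots> \<le> (x $ i)\<^sup>2" by simp
      finally show "(\<Sum>j\<in>UNIV. ?h i j) \<le> (x $ i)\<^sup>2" .
    qed
    finally show ?thesis using eq by simp
  qed
  ultimately show ?thesis by (simp add: pos_semidef_def)
qed

section \<open>Existence and uniqueness for Lipschitz differential equations\<close>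

lemma has_real_derivative_nonneg_imp_mono:
  fixes f :: "real \<Rightarrow> real"
  assumes f: "\<And>t. t \<in> {a..b} \<Longrightarrow> (f has_real_derivative f' t) (at t within {a..b})"
    and "\<And>t. t \<in> {a..b} \<Longrightarrow> 0 \<le> f' t"
    and xy: "a \<le> x" "x \<le> y" "y \<le> b"
  shows "f x \<le> f y"
proof (rule DERIV_nonneg_imp_increasing_open[OF xy(2)])
  show "\<exists>d. (f has_real_derivative d) (at t) \<and> 0 \<le> d" if "x < t" "t < y" for t
    using f[of t] assms(2)[of t] that xy by (intro exI[of _ "f' t"]) (simp add: at_within_Icc_at)
  have "continuous_on {a..b} f" using f by (metis DERIV_continuous_on)
  then show "continuous_on {x..y} f" by (rule continuous_on_subset) (use xy in auto)
qed

text \<open>The function \<open>exp (- K t) f t\<close> is nonincreasing.\<close>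

lemma real_gronwall:
  fixes f :: "real \<Rightarrow> real"
  assumes f: "\<And>t. t \<in> {0..T} \<Longrightarrow> (f has_real_derivative f' t) (at t within {0..T})"
    and le: "\<And>t. t \<in> {0..T} \<Longrightarrow> f' t \<le> K * f t" and t: "t \<in> {0..T}"
  shows "f t \<le> f 0 * exp (K * t)"
proof -
  have "- (exp (- K * 0) * f 0) \<le> - (exp (- K * t) * f t)"
  proof (rule has_real_derivative_nonneg_imp_mono[where f = "\<lambda>t. - (exp (- K * t) * f t)"
        and f' = "\<lambda>s. exp (- K * s) * (K * f s - f' s)" and a = 0 and b = T])
    show "((\<lambda>t. - (exp (- K * t) * f t)) has_real_derivative
        exp (- K * s) * (K * f s - f' s)) (at s within {0..T})" if "s \<in> {0..T}" for s
      by (rule derivative_eq_intros f[OF that] refl | simp add: algebra_simps)+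
  qed (use le t in auto)
  then show ?thesis by (simp add: exp_minus field_simps)
qed

text \<open>The squared distance \<open>w\<close> of two solutions satisfies \<open>w' \<le> 2 K w\<close>. Only the set \<open>S\<close> that both
  solutions visit matters, which permits a merely local Lipschitz condition.\<close>

lemma lipschitz_ode_unique:
  fixes F :: "real \<Rightarrow> 'a::real_inner \<Rightarrow> 'a"
  assumes r: "\<And>t. t \<in> {0..T} \<Longrightarrow> (r has_vector_derivative F t (r t)) (at t within {0..T})"
    and s: "\<And>t. t \<in> {0..T} \<Longrightarrow> (s has_vector_derivative F t (s t)) (at t within {0..T})"
    and S: "\<And>t. t \<in> {0..T} \<Longrightarrow> r t \<in> S" "\<And>t. t \<in> {0..T} \<Longrightarrow> s t \<in> S"
    and lip: "\<And>t. t \<in> {0..T} \<Longrightarrow> K-lipschitz_on S (F t)"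
    and init: "r 0 = s 0" and t: "t \<in> {0..T}"
  shows "r t = s t"
proof -
  let ?w = "\<lambda>t. (r t - s t) \<bullet> (r t - s t)"
  have "?w t \<le> ?w 0 * exp (2 * K * t)"
  proof (rule real_gronwall[where f = ?w and K = "2 * K" and T = T])
    fix t assume t: "t \<in> {0..T}"
    let ?d = "F t (r t) - F t (s t)"
    have "((\<lambda>t. r t - s t) has_vector_derivative ?d) (at t within {0..T})"
      by (intro has_vector_derivative_diff r s t)
    then have d: "((\<lambda>t. r t - s t) has_derivative (\<lambda>h. h *\<^sub>R ?d)) (at t within {0..T})"
      by (simp add: has_vector_derivative_def)
    have "(\<lambda>h. (r t - s t) \<bullet> (h *\<^sub>R ?d) + (h *\<^sub>R ?d) \<bullet> (r t - s t)) =
        (*) (2 * ((r t - s t) \<bullet> ?d))"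
      by (intro ext) (simp add: inner_commute[of ?d])
    then show "(?w has_real_derivative 2 * ((r t - s t) \<bullet> ?d)) (at t within {0..T})"
      using has_derivative_inner[OF d d] by (simp add: has_field_derivative_def)
    have "(r t - s t) \<bullet> ?d \<le> norm (r t - s t) * norm ?d" by (rule norm_cauchy_schwarz)
    also have "\<dots> \<le> norm (r t - s t) * (K * norm (r t - s t))"
      using lipschitz_onD[OF lip[OF t] S(1)[OF t] S(2)[OF t]]
      by (intro mult_left_mono) (auto simp: dist_norm)
    finally show "2 * ((r t - s t) \<bullet> ?d) \<le> 2 * K * ?w t"
      by (simp add: dot_square_norm power2_eq_square algebra_simps)
  qed (rule t)
  then have "(r t - s t) \<bullet> (r t - s t) \<le> 0" by (simp add: init)
  then have "r t - s t = 0" by (metis inner_gt_zero_iff not_less)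
  then show ?thesis by simp
qed

text \<open>Global existence on all of \<open>[0, T]\<close> in one step: the Picard operator is a contraction for the
  weighted norm \<open>sup\<^sub>t exp (- \<kappa> t) \<parallel>r t\<parallel>\<close> when \<open>\<kappa> > K\<close>. The weight is absorbed into the unknown
  \<open>u t = exp (- \<kappa> t) r t\<close>, so that the ordinary supremum norm of bounded continuous functions can be
  used.\<close>

lemma lipschitz_ode_exists:
  fixes F :: "real \<Rightarrow> 'a::banach \<Rightarrow> 'a"
  assumes T: "0 \<le> T" and cont: "continuous_on ({0..T} \<times> UNIV) (\<lambda>(t, x). F t x)"
    and lip: "\<And>t. t \<in> {0..T} \<Longrightarrow> K-lipschitz_on UNIV (F t)"
  shows "\<exists>r. r 0 = x0 \<and>
    (\<forall>t\<in>{0..T}. (r has_vector_derivative F t (r t)) (at t within {0..T}))"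
proof -
  have K: "0 \<le> K" using lip[of 0] T by (auto dest: lipschitz_on_nonneg)
  \<comment> \<open>Any \<open>\<kappa> \<ge> 2 K\<close> yields contraction factor \<open>1/2\<close>; the summand \<open>1\<close> keeps \<open>\<kappa>\<close> positive.\<close>
  define \<kappa> where "\<kappa> = 2 * K + 1"
  have \<kappa>: "0 < \<kappa>" using K by (simp add: \<kappa>_def)
  \<comment> \<open>Bounded continuous functions live on the whole real line; \<open>cl\<close> retracts it onto \<open>[0, T]\<close>.\<close>
  define cl where "cl t = max 0 (min T t)" for t :: real
  have cl: "cl t \<in> {0..T}" for t using T by (auto simp: cl_def)
  have cl_id: "cl t = t" if "t \<in> {0..T}" for t using that by (auto simp: cl_def)
  have cont_F: "continuous_on {0..T} (\<lambda>s. F s (h s))" if "continuous_on {0..T} h" for h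
    using continuous_on_compose2[OF cont, of "{0..T}" "\<lambda>s. (s, h s)"] that
    by (force intro!: continuous_intros)
  define P where "P u t = exp (- \<kappa> * t) *\<^sub>R
      (x0 + integral {0..t} (\<lambda>s. F s (exp (\<kappa> * s) *\<^sub>R apply_bcontfun u s)))" for u t
  have int: "continuous_on {0..T} (\<lambda>s. F s (exp (\<kappa> * s) *\<^sub>R apply_bcontfun u s))" for u
    by (intro cont_F continuous_intros) auto
  have P: "continuous_on {0..T} (P u)" for u
    unfolding P_def using int[of u]
    by (intro continuous_intros indefinite_integral_continuous_1 integrable_continuous_real)
  have "(\<lambda>t. P u (cl t)) \<in> bcontfun" for u
  proof -
    have c: "continuous_on UNIV (\<lambda>t. P u (cl t))"
      by (rule continuous_on_compose2[OF P]) (use cl in \<open>auto simp: cl_def intro!: continuous_intros\<close>)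
    have "bounded (P u ` {0..T})"
      using P compact_continuous_image compact_imp_bounded compact_Icc by blast
    then obtain b where "\<forall>t\<in>{0..T}. norm (P u t) \<le> b"
      by (auto simp: bounded_iff)
    then show ?thesis using cl c by (intro bcontfun_normI) auto
  qed
  then have app: "apply_bcontfun (Bcontfun (\<lambda>t. P u (cl t))) = (\<lambda>t. P u (cl t))" for u
    by (simp add: Bcontfun_inverse)
  have "dist (Bcontfun (\<lambda>t. P u (cl t))) (Bcontfun (\<lambda>t. P v (cl t))) \<le> 1 / 2 * dist u v" for u v
  proof (rule dist_bound)
    fix t0 :: real
    define t where "t = cl t0"
    have t: "t \<in> {0..T}" using cl by (simp add: t_def)
    have sub: "{0..t} \<subseteq> {0..T}" using t by auto
    let ?f = "\<lambda>u s. F s (exp (\<kappa> * s) *\<^sub>R apply_bcontfun u s)"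
    note int' = continuous_on_subset[OF int sub]
    have exp_int: "((\<lambda>s. K * dist u v * exp (\<kappa> * s)) has_integral
        K * dist u v * exp (\<kappa> * t) / \<kappa> - K * dist u v * exp (\<kappa> * 0) / \<kappa>) {0..t}"
      using t \<kappa> by (intro fundamental_theorem_of_calculus)
        (auto simp flip: has_real_derivative_iff_has_vector_derivative intro!: derivative_eq_intros)
    have "P u t - P v t = exp (- \<kappa> * t) *\<^sub>R (integral {0..t} (\<lambda>s. ?f u s - ?f v s))"
      unfolding P_def using int'
      by (subst Henstock_Kurzweil_Integration.integral_diff)
        (auto intro: integrable_continuous_real simp: algebra_simps)
    then have "dist (P u t) (P v t) = exp (- \<kappa> * t) * norm (integral {0..t} (\<lambda>s. ?f u s - ?f v s))"
      by (simp add: dist_norm)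
    also have "norm (integral {0..t} (\<lambda>s. ?f u s - ?f v s))
        \<le> integral {0..t} (\<lambda>s. K * dist u v * exp (\<kappa> * s))"
    proof (rule integral_norm_bound_integral)
      show "(\<lambda>s. ?f u s - ?f v s) integrable_on {0..t}"
        using int' by (intro integrable_continuous_real continuous_intros)
      show "(\<lambda>s. K * dist u v * exp (\<kappa> * s)) integrable_on {0..t}" using exp_int by blast
      fix s assume "s \<in> {0..t}"
      then have "s \<in> {0..T}" using sub by blast
      from lipschitz_onD[OF lip[OF this], of "exp (\<kappa> * s) *\<^sub>R u s" "exp (\<kappa> * s) *\<^sub>R v s"]
      have "norm (?f u s - ?f v s) \<le> K * (exp (\<kappa> * s) * dist (u s) (v s))"
        by (simp add: dist_norm flip: scaleR_diff_right)
      also have "\<dots> \<le> K * (exp (\<kappa> * s) * dist u v)"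
        using K by (intro mult_left_mono dist_bounded) auto
      finally show "norm (?f u s - ?f v s) \<le> K * dist u v * exp (\<kappa> * s)" by (simp add: mult_ac)
    qed
    also have "integral {0..t} (\<lambda>s. K * dist u v * exp (\<kappa> * s)) \<le> K * dist u v * exp (\<kappa> * t) / \<kappa>"
      using exp_int K \<kappa> by (subst integral_unique) (auto simp: zero_le_divide_iff)
    also have "exp (- \<kappa> * t) * (K * dist u v * exp (\<kappa> * t) / \<kappa>) = K / \<kappa> * dist u v"
      by (simp add: exp_minus)
    also have "\<dots> \<le> 1 / 2 * dist u v"
      using K \<kappa> by (intro mult_right_mono) (auto simp: \<kappa>_def field_simps)
    finally show "dist (apply_bcontfun (Bcontfun (\<lambda>t. P u (cl t))) t0)
        (apply_bcontfun (Bcontfun (\<lambda>t. P v (cl t))) t0) \<le> 1 / 2 * dist u v"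
      by (simp add: app t_def mult_left_mono)
  qed
  then have "\<exists>!u. Bcontfun (\<lambda>t. P u (cl t)) = u"
    by (intro banach_fix_type[of "1/2"]) auto
  then obtain u where "Bcontfun (\<lambda>t. P u (cl t)) = u" by blast
  then have u: "apply_bcontfun u t = P u t" if "t \<in> {0..T}" for t
    using app[of u] cl_id[OF that] by metis
  define r where "r t = exp (\<kappa> * t) *\<^sub>R apply_bcontfun u t" for t
  have r: "r t = x0 + integral {0..t} (\<lambda>s. F s (r s))" if "t \<in> {0..T}" for t
    using u[OF that] by (simp add: r_def P_def exp_minus)
  have "(r has_vector_derivative F t (r t)) (at t within {0..T})" if t: "t \<in> {0..T}" for t
  proof (rule has_vector_derivative_transform[OF t])
    have "((\<lambda>t. integral {0..t} (\<lambda>s. F s (r s))) has_vector_derivative F t (r t)) (at t within {0..T})"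
      using integral_has_vector_derivative[OF int[of u] t] by (simp add: r_def)
    then show "((\<lambda>t. x0 + integral {0..t} (\<lambda>s. F s (r s))) has_vector_derivative F t (r t))
        (at t within {0..T})"
      using has_vector_derivative_add[OF has_vector_derivative_const] by fastforce
  qed (rule r)
  moreover have "r 0 = x0" using r[of 0] T by simp
  ultimately show ?thesis by blast
qed

section \<open>Lipschitz continuity of products, roots and reciprocals\<close>

text \<open>A Lipschitz function is bounded on a bounded set, and a product of bounded Lipschitz functions is
  Lipschitz.\<close>

lemma lipschitz_on_mult_bounded_domain:
  fixes f g :: "'a::heine_borel \<Rightarrow> real"
  assumes "bounded S" and f: "C-lipschitz_on S f" and g: "D-lipschitz_on S g"
  shows "\<exists>E. E-lipschitz_on S (\<lambda>x. f x * g x)"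
proof -
  have "bounded (f ` S)" "bounded (g ` S)"
    using bounded_uniformly_continuous_image[OF lipschitz_on_uniformly_continuous \<open>bounded S\<close>] f g
    by blast+
  then obtain A B where A: "\<And>x. x \<in> S \<Longrightarrow> \<bar>f x\<bar> \<le> A" and B: "\<And>x. x \<in> S \<Longrightarrow> \<bar>g x\<bar> \<le> B"
    by (auto simp: bounded_iff)
  have "(\<bar>A\<bar> * D + \<bar>B\<bar> * C)-lipschitz_on S (\<lambda>x. f x * g x)"
  proof (rule lipschitz_onI)
    fix x y assume xy: "x \<in> S" "y \<in> S"
    have "f x * g x - f y * g y = f x * (g x - g y) + g y * (f x - f y)" by algebra
    then have "\<bar>f x * g x - f y * g y\<bar> \<le> \<bar>f x\<bar> * \<bar>g x - g y\<bar> + \<bar>g y\<bar> * \<bar>f x - f y\<bar>"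
      by (metis abs_mult abs_triangle_ineq)
    also have "\<dots> \<le> \<bar>A\<bar> * (D * dist x y) + \<bar>B\<bar> * (C * dist x y)"
      using A[OF xy(1)] B[OF xy(2)] lipschitz_onD[OF f xy] lipschitz_onD[OF g xy]
      by (intro add_mono mult_mono) (auto simp: dist_real_def)
    finally show "dist (f x * g x) (f y * g y) \<le> (\<bar>A\<bar> * D + \<bar>B\<bar> * C) * dist x y"
      by (simp add: dist_real_def algebra_simps)
  qed (use lipschitz_on_nonneg[OF f] lipschitz_on_nonneg[OF g] in auto)
  then show ?thesis by blast
qed

lemma lipschitz_on_prod_bounded_domain:
  fixes f :: "'i \<Rightarrow> 'a::heine_borel \<Rightarrow> real"
  assumes S: "bounded S" and "finite I" and "\<And>i. i \<in> I \<Longrightarrow> \<exists>C. C-lipschitz_on S (f i)"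
  shows "\<exists>C. C-lipschitz_on S (\<lambda>x. \<Prod>i\<in>I. f i x)"
  using assms(2,3)
proof (induction I)
  case empty
  show ?case using lipschitz_on_constant by auto
next
  case (insert i I)
  then obtain C D where "C-lipschitz_on S (f i)" "D-lipschitz_on S (\<lambda>x. \<Prod>i\<in>I. f i x)" by blast
  then show ?case using lipschitz_on_mult_bounded_domain[OF S] insert.hyps by simp
qed

text \<open>The \<open>n\<close>-th power expands distances on \<open>[1, \<infinity>)\<close>: for \<open>1 \<le> u \<le> v\<close> one has
  \<open>v\<^sup>n - u\<^sup>n \<ge> (v - u) v\<^bsup>n - 1\<^esup> \<ge> v - u\<close>.\<close>

lemma lipschitz_on_root: "0 < n \<Longrightarrow> 1-lipschitz_on {1..} (root n)"
proof (rule lipschitz_onI)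
  fix x y :: real assume n: "0 < n"
  have *: "root n b - root n a \<le> b - a" if "1 \<le> a" "a \<le> b" for a b
  proof -
    define u v where "u = root n a" "v = root n b"
    have u: "1 \<le> u" and uv: "u \<le> v" using that n by (simp_all add: u_v_def)
    obtain m where m: "n = Suc m" using n by (cases n) auto
    have "v - u \<le> (v - u) * v ^ m"
      using u uv by (simp add: mult_left_le[of 1] mult_le_cancel_left1)
    also have "\<dots> \<le> v ^ n - u ^ n"
      using u uv mult_left_mono[OF power_mono[of u v m], of u] by (simp add: m algebra_simps)
    also have "\<dots> = b - a" using that n by (simp add: u_v_def)
    finally show ?thesis by (simp add: u_v_def)
  qed
  assume "x \<in> {1..}" "y \<in> {1..}"
  then show "dist (root n x) (root n y) \<le> 1 * dist x y"
    using *[of x y] *[of y x] n by (cases "x \<le> y") (auto simp: dist_real_def abs_if)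
qed simp

lemma lipschitz_on_inverse: "1-lipschitz_on {1::real..} (\<lambda>x. 1 / x)"
proof (rule lipschitz_onI)
  fix x y :: real assume xy: "x \<in> {1..}" "y \<in> {1..}"
  then have "1 / x - 1 / y = (y - x) / (x * y)" by (simp add: field_simps)
  moreover have "1 \<le> x * y" using xy mult_mono[of 1 x 1 y] by simp
  ultimately show "dist (1 / x) (1 / y) \<le> 1 * dist x y"
    by (simp add: dist_real_def divide_le_eq abs_minus_commute mult_le_cancel_left1)
qed simp

section \<open>The rate function in eigenvalue coordinates\<close>

text \<open>The right-hand side of the matrix equation is \<open>(1/c) Tr(Q'(X) E) E\<close> with \<open>E = matexp (- t (a + q) L)\<close>.
  The function \<open>eig_rate\<close> is the scalar factor \<open>(1/c) Tr(Q'(X) E)\<close> in terms of the eigenvalues \<open>lam\<close> of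
  \<open>L\<close>, \<open>e\<close> of \<open>E\<close> and \<open>x\<close> of \<open>X\<close>; see \<open>eig_rate_eq_trace\<close>.\<close>

definition eig_rate :: "real \<Rightarrow> real ^ 'n \<Rightarrow> real ^ 'n \<Rightarrow> real ^ 'n \<Rightarrow> real" where
  "eig_rate c lam e x = 1 / real CARD('n) * root CARD('n) (\<Prod>i\<in>UNIV. 1 + c * lam $ i * x $ i) *
     (\<Sum>i\<in>UNIV. lam $ i * e $ i / (1 + c * lam $ i * x $ i))"

lemma eig_rate_eq_trace:
  assumes U: "orthogonal_matrix U" and c: "0 < c"
    and lam: "\<And>i. 0 \<le> lam $ i" and x: "\<And>i. 0 \<le> x $ i"
  shows "1 / c * trace (Qderiv c (conj_diag U lam) (conj_diag U x) ** conj_diag U e) = eig_rate c lam e x"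
proof -
  let ?y = "\<chi> i. 1 + c * lam $ i * x $ i"
  have "0 \<le> c * lam $ i * x $ i" for i using c lam x by simp
  then have y: "1 + c * lam $ i * x $ i \<noteq> 0" for i by (metis add_nonneg_eq_0_iff zero_le_one zero_neq_one)
  have "1 + c *\<^sub>R (x * lam) = ?y" by (simp add: vec_eq_iff mult_ac)
  then have M: "mat 1 + c *\<^sub>R (conj_diag U x ** conj_diag U lam) = conj_diag U ?y"
    by (simp add: conj_diag_mult[OF U] flip: conj_diag_1[OF U] conj_diag_scaleR conj_diag_add)
  have "Qderiv c (conj_diag U lam) (conj_diag U x) ** conj_diag U e =
     (1 / real CARD('a) * root CARD('a) (\<Prod>i\<in>UNIV. ?y $ i) * c) *\<^sub>R conj_diag U ((\<chi> i. 1 / ?y $ i) * lam * e)"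
    unfolding Qderiv_def Qfun_def M using y
    by (simp add: matrix_inv_conj_diag[OF U] det_conj_diag[OF U] scaleR_matrix_mult_left
        scaleR_matrix_mult_right conj_diag_mult[OF U])
  moreover have "trace (r *\<^sub>R A) = r * trace A" for r and A :: "real^'a^'a"
    by (simp add: trace_def sum_distrib_left)
  ultimately show ?thesis using c
    by (simp add: trace_conj_diag[OF U] eig_rate_def)
qed

context
  fixes c :: real and lam :: "real ^ 'n"
  assumes c: "0 < c" and lam: "\<And>i. 0 \<le> lam $ i"
begin

lemma eig_factor_ge_1: "0 \<le> a \<Longrightarrow> 1 \<le> 1 + c * lam $ i * a"
  using c lam by simp

lemma eig_rate_nonneg:
  assumes "\<And>i. 0 \<le> e $ i" "\<And>i. 0 \<le> x $ i"
  shows "0 \<le> eig_rate c lam e x"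
  unfolding eig_rate_def using assms lam c
  by (intro mult_nonneg_nonneg sum_nonneg divide_nonneg_nonneg real_root_ge_zero prod_nonneg) auto

text \<open>Linear growth: the geometric mean is at most the largest factor, each factor is at most
  \<open>1 + c Lam (\<Sum>i\<in>UNIV. x $ i)\<close>, and the remaining sum is at most \<open>Lam\<close> because every denominator is at
  least \<open>1\<close>. This bound prevents blow-up in finite time.\<close>

lemma eig_rate_le:
  assumes e: "\<And>i. 0 \<le> e $ i" "\<And>i. e $ i \<le> 1" and x: "\<And>i. 0 \<le> x $ i"
  defines "Lam \<equiv> (\<Sum>i\<in>UNIV. lam $ i)"
  shows "real CARD('n) * eig_rate c lam e x \<le> Lam * (1 + c * Lam) * (1 + (\<Sum>i\<in>UNIV. x $ i))"
proof -
  let ?s = "\<Sum>i\<in>UNIV. x $ i"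
  have s: "0 \<le> ?s" using x by (simp add: sum_nonneg)
  have Lam: "0 \<le> Lam" unfolding Lam_def using lam by (simp add: sum_nonneg)
  have fac: "1 + c * lam $ i * x $ i \<le> 1 + c * Lam * ?s" for i
  proof -
    have "lam $ i \<le> Lam" "x $ i \<le> ?s"
      unfolding Lam_def using lam x by (auto intro!: member_le_sum)
    then show ?thesis using c lam x Lam s by (simp add: mult.assoc mult_mono)
  qed
  have "(\<Prod>i\<in>(UNIV::'n set). 1 + c * lam $ i * x $ i) \<le> (\<Prod>i\<in>(UNIV::'n set). 1 + c * Lam * ?s)"
    using fac eig_factor_ge_1[OF x] by (intro prod_mono) (auto intro: order_trans[OF zero_le_one])
  then have "root CARD('n) (\<Prod>i\<in>UNIV. 1 + c * lam $ i * x $ i) \<le> root CARD('n) ((1 + c * Lam * ?s) ^ CARD('n))"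
    by simp
  also have "\<dots> = 1 + c * Lam * ?s" using c Lam s by (intro real_root_power_cancel) auto
  also have "\<dots> \<le> (1 + c * Lam) * (1 + ?s)" using c Lam s by (simp add: algebra_simps)
  finally have root: "root CARD('n) (\<Prod>i\<in>UNIV. 1 + c * lam $ i * x $ i) \<le> (1 + c * Lam) * (1 + ?s)" .
  have "(\<Sum>i\<in>UNIV. lam $ i * e $ i / (1 + c * lam $ i * x $ i)) \<le> Lam"
    unfolding Lam_def
  proof (rule sum_mono)
    fix i
    have "lam $ i * e $ i / (1 + c * lam $ i * x $ i) \<le> lam $ i * 1 / 1"
      using lam e eig_factor_ge_1[OF x] by (intro frac_le mult_mono) auto
    then show "lam $ i * e $ i / (1 + c * lam $ i * x $ i) \<le> lam $ i" by simp
  qed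
  then have "root CARD('n) (\<Prod>i\<in>UNIV. 1 + c * lam $ i * x $ i) *
      (\<Sum>i\<in>UNIV. lam $ i * e $ i / (1 + c * lam $ i * x $ i)) \<le> (1 + c * Lam) * (1 + ?s) * Lam"
    using root c Lam s lam e x by (intro mult_mono) (auto intro!: sum_nonneg divide_nonneg_nonneg)
  then show ?thesis by (simp add: eig_rate_def mult_ac)
qed

text \<open>Root and reciprocal are applied only to arguments that are at least \<open>1\<close>. The constant is
  uniform in \<open>e\<close>, hence uniform in time.\<close>

lemma eig_rate_lipschitz:
  "\<exists>K. \<forall>e. (\<forall>i. 0 \<le> e $ i \<and> e $ i \<le> 1) \<longrightarrow> K-lipschitz_on {x. \<forall>i. 0 \<le> x $ i \<and> x $ i \<le> M} (eig_rate c lam e)"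
proof -
  let ?S = "{x :: real ^ 'n. \<forall>i. 0 \<le> x $ i \<and> x $ i \<le> M}"
  let ?f = "\<lambda>i x. 1 + c * lam $ i * x $ i"
  let ?Q = "\<lambda>x. root CARD('n) (\<Prod>i\<in>UNIV. ?f i x)"
  have "?S = cbox 0 (\<chi> i. M)" by (auto simp: mem_box_cart)
  then have S: "bounded ?S" by (simp add: bounded_cbox)
  have f: "(c * lam $ i)-lipschitz_on ?S (?f i)" for i
  proof (rule lipschitz_onI)
    fix x y
    have "dist (?f i x) (?f i y) = c * lam $ i * dist (x $ i) (y $ i)"
      using c lam by (simp add: dist_real_def abs_mult flip: right_diff_distrib)
    also have "\<dots> \<le> c * lam $ i * dist x y"
      using c lam by (intro mult_left_mono dist_vec_nth_le) auto
    finally show "dist (?f i x) (?f i y) \<le> c * lam $ i * dist x y" .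
  qed (use c lam in auto)
  have "1 \<le> (\<Prod>i\<in>UNIV. ?f i x)" if "x \<in> ?S" for x
    using that eig_factor_ge_1 by (intro prod_ge_1) auto
  moreover obtain D where "D-lipschitz_on ?S (\<lambda>x. \<Prod>i\<in>UNIV. ?f i x)"
    using lipschitz_on_prod_bounded_domain[OF S finite, of UNIV ?f] f by blast
  ultimately have Q: "(1 * D)-lipschitz_on ?S ?Q"
    by (intro lipschitz_on_compose2 lipschitz_on_subset[OF lipschitz_on_root]) auto
  have "(1 * (c * lam $ i))-lipschitz_on ?S (\<lambda>x. 1 / ?f i x)" for i
    using eig_factor_ge_1
    by (intro lipschitz_on_compose2[OF f] lipschitz_on_subset[OF lipschitz_on_inverse]) auto
  then have "\<exists>C. C-lipschitz_on ?S (\<lambda>x. ?Q x * (1 / ?f i x))" for i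
    by (rule lipschitz_on_mult_bounded_domain[OF S Q])
  moreover define h where "h i x = ?Q x * (1 / ?f i x)" for i x
  ultimately have "\<exists>C. C-lipschitz_on ?S (h i)" for i by simp
  then have "\<exists>C. \<forall>i. (C i)-lipschitz_on ?S (h i)" by (intro choice allI)
  then obtain C where C: "\<And>i. (C i)-lipschitz_on ?S (h i)" by blast
  have "(\<Sum>i\<in>UNIV. lam $ i * C i)-lipschitz_on ?S (eig_rate c lam e)" if e: "\<forall>i. 0 \<le> e $ i \<and> e $ i \<le> 1" for e
  proof (rule lipschitz_onI)
    fix x y assume xy: "x \<in> ?S" "y \<in> ?S"
    have eq: "eig_rate c lam e z = (\<Sum>i\<in>UNIV. lam $ i * (e $ i / CARD('n)) * h i z)" for z
      by (simp add: eig_rate_def h_def sum_distrib_left sum_divide_distrib mult_ac)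
    have "dist (eig_rate c lam e x) (eig_rate c lam e y) \<le>
        (\<Sum>i\<in>UNIV. \<bar>lam $ i * (e $ i / CARD('n)) * (h i x - h i y)\<bar>)"
      unfolding eq dist_real_def sum_subtractf[symmetric] right_diff_distrib[symmetric] by (rule sum_abs)
    also have "\<dots> \<le> (\<Sum>i\<in>UNIV. lam $ i * 1 * (C i * dist x y))"
    proof (rule sum_mono)
      fix i
      have "e $ i / CARD('n) \<le> 1 / 1" using e by (intro frac_le) auto
      moreover have "\<bar>h i x - h i y\<bar> \<le> C i * dist x y"
        using lipschitz_onD[OF C xy] by (simp add: dist_real_def)
      ultimately show "\<bar>lam $ i * (e $ i / CARD('n)) * (h i x - h i y)\<bar> \<le> lam $ i * 1 * (C i * dist x y)"
        unfolding abs_mult using lam e by (intro mult_mono) auto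
    qed
    finally show "dist (eig_rate c lam e x) (eig_rate c lam e y) \<le> (\<Sum>i\<in>UNIV. lam $ i * C i) * dist x y"
      by (simp add: sum_distrib_right mult.assoc)
  qed (use lam lipschitz_on_nonneg[OF C] in \<open>auto intro!: sum_nonneg\<close>)
  then show ?thesis by blast
qed

end

section \<open>The system of eigenvalues\<close>

definition decay :: "real \<Rightarrow> real ^ 'n \<Rightarrow> real \<Rightarrow> real ^ 'n" where
  "decay k lam t = (\<chi> i. exp (- t * k * lam $ i))"

definition truncate :: "real \<Rightarrow> real ^ 'n \<Rightarrow> real ^ 'n" where
  "truncate M x = (\<chi> i. max 0 (min M (x $ i)))"

lemma lipschitz_truncate: "1-lipschitz_on UNIV (truncate M)"
proof (rule lipschitz_onI)
  fix x y :: "real ^ 'a"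
  have "norm (truncate M x - truncate M y) \<le> norm (x - y)"
    by (rule norm_le_componentwise_cart) (auto simp: truncate_def)
  then show "dist (truncate M x) (truncate M y) \<le> 1 * dist x y" by (simp add: dist_norm)
qed simp

lemma decay_bounds:
  assumes "0 \<le> k" "\<And>i. 0 \<le> lam $ i" "0 \<le> t"
  shows "0 \<le> decay k lam t $ i" "decay k lam t $ i \<le> 1"
  using assms by (auto simp: decay_def mult_nonneg_nonneg)

lemma lipschitz_on_scaleR_unit_box:
  fixes e :: "real ^ 'n"
  assumes g: "K-lipschitz_on S g" and e: "\<And>i. 0 \<le> e $ i" "\<And>i. e $ i \<le> 1"
  shows "(K * CARD('n))-lipschitz_on S (\<lambda>x. g x *\<^sub>R e)"
proof (rule lipschitz_onI)
  fix x y assume xy: "x \<in> S" "y \<in> S"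
  have "norm e \<le> (\<Sum>i\<in>UNIV. \<bar>e $ i\<bar>)" by (rule norm_le_l1_cart)
  also have "\<dots> \<le> (\<Sum>i\<in>(UNIV::'n set). 1)" using e by (intro sum_mono) auto
  finally have n: "norm e \<le> real CARD('n)" by simp
  have "dist (g x *\<^sub>R e) (g y *\<^sub>R e) = dist (g x) (g y) * norm e"
    by (simp add: dist_norm flip: scaleR_diff_left)
  also have "\<dots> \<le> K * dist x y * CARD('n)"
    using lipschitz_onD[OF g xy] n lipschitz_on_nonneg[OF g] by (intro mult_mono) auto
  finally show "dist (g x *\<^sub>R e) (g y *\<^sub>R e) \<le> K * CARD('n) * dist x y" by (simp add: mult_ac)
qed (use lipschitz_on_nonneg[OF g] in auto)

lemma has_real_derivative_component:
  "(r has_vector_derivative d) F \<Longrightarrow> ((\<lambda>t. r t $ i) has_real_derivative d $ i) F"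
  unfolding has_real_derivative_iff_has_vector_derivative
  by (rule bounded_linear.has_vector_derivative[OF bounded_linear_vec_nth])

definition eig_solution :: "real \<Rightarrow> real \<Rightarrow> real ^ 'n \<Rightarrow> real \<Rightarrow> (real \<Rightarrow> real ^ 'n) \<Rightarrow> bool" where
  "eig_solution c k lam T r \<longleftrightarrow> r 0 = 0 \<and> (\<forall>t\<in>{0..T}. (\<forall>i. 0 \<le> r t $ i) \<and>
     (r has_vector_derivative eig_rate c lam (decay k lam t) (r t) *\<^sub>R decay k lam t) (at t within {0..T}))"

text \<open>The truncated field is globally Lipschitz. A solution of it starts at \<open>0\<close> and has nonnegative
  derivative, so it is nonnegative; by linear growth of the rate and Gronwall's inequality it never
  exceeds \<open>M = exp (B T)\<close>, so it solves the original system.\<close>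

lemma eig_solution_exists:
  fixes lam :: "real ^ 'n"
  assumes c: "0 < c" and lam: "\<And>i. 0 \<le> lam $ i" and k: "0 \<le> k" and T: "0 < T"
  shows "\<exists>r. eig_solution c k lam T r"
proof -
  define Lam where "Lam = (\<Sum>i\<in>UNIV. lam $ i)"
  define B where "B = Lam * (1 + c * Lam)"
  have "0 \<le> Lam" unfolding Lam_def using lam by (simp add: sum_nonneg)
  then have B: "0 \<le> B" using c by (simp add: B_def)
  define M where "M = exp (B * T)"
  have M: "0 \<le> M" by (simp add: M_def)
  define g where "g t x = eig_rate c lam (decay k lam t) (truncate M x)" for t x
  have trunc: "0 \<le> truncate M x $ i" "truncate M x $ i \<le> M" for x :: "real ^ 'n" and i
    using M by (auto simp: truncate_def)
  note e = decay_bounds[OF k lam]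
  obtain K where K: "\<And>e. (\<forall>i. 0 \<le> e $ i \<and> e $ i \<le> 1) \<Longrightarrow>
      K-lipschitz_on {x. \<forall>i. 0 \<le> x $ i \<and> x $ i \<le> M} (eig_rate c lam e)"
    using eig_rate_lipschitz[OF c lam, of M] by blast
  have g_lip: "K-lipschitz_on UNIV (g t)" if "t \<in> {0..T}" for t
  proof -
    have "(K * 1)-lipschitz_on UNIV (\<lambda>x. eig_rate c lam (decay k lam t) (truncate M x))"
      using that e trunc
      by (intro lipschitz_on_compose2[OF lipschitz_truncate] lipschitz_on_subset[OF K]) auto
    then show ?thesis by (simp add: g_def[abs_def])
  qed
  have lip: "(K * CARD('n))-lipschitz_on UNIV (\<lambda>x. g t x *\<^sub>R decay k lam t)" if t: "t \<in> {0..T}" for t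
    using t e by (intro lipschitz_on_scaleR_unit_box g_lip) auto
  have "1 + c * lam $ i * max 0 (min M a) \<noteq> 0" for i a
    using eig_factor_ge_1[where c = c and lam = lam, OF c lam, of "max 0 (min M a)" i] by auto
  then have cont: "continuous_on ({0..T} \<times> UNIV) (\<lambda>(t, x). g t x *\<^sub>R decay k lam t)"
    unfolding g_def eig_rate_def decay_def truncate_def case_prod_beta vec_lambda_beta
    by (intro continuous_intros) auto
  obtain r where r0: "r 0 = 0" and r: "\<And>t. t \<in> {0..T} \<Longrightarrow>
      (r has_vector_derivative g t (r t) *\<^sub>R decay k lam t) (at t within {0..T})"
    using lipschitz_ode_exists[OF less_imp_le[OF T] cont lip, of 0] by blast
  have g_nonneg: "0 \<le> g t x" if "t \<in> {0..T}" for t x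
    unfolding g_def using that e trunc by (intro eig_rate_nonneg[OF c lam]) auto
  have r_nonneg: "0 \<le> r t $ i" if t: "t \<in> {0..T}" for t i
  proof -
    have "r 0 $ i \<le> r t $ i"
    proof (rule has_real_derivative_nonneg_imp_mono[where a = 0 and b = T
          and f = "\<lambda>s. r s $ i" and f' = "\<lambda>s. (g s (r s) *\<^sub>R decay k lam s) $ i"])
      show "((\<lambda>t. r t $ i) has_real_derivative (g s (r s) *\<^sub>R decay k lam s) $ i) (at s within {0..T})"
        if "s \<in> {0..T}" for s using r[OF that] by (rule has_real_derivative_component)
    qed (use t e g_nonneg in auto)
    then show ?thesis by (simp add: r0)
  qed
  have r_le: "r t $ i \<le> M" if t: "t \<in> {0..T}" for t i
  proof -
    let ?v = "\<lambda>t. 1 + (\<Sum>i\<in>UNIV. r t $ i)"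
    have "?v t \<le> ?v 0 * exp (B * t)"
    proof (rule real_gronwall[where f = ?v and T = T
          and f' = "\<lambda>s. \<Sum>i\<in>UNIV. (g s (r s) *\<^sub>R decay k lam s) $ i"])
      fix s assume s: "s \<in> {0..T}"
      show "(?v has_real_derivative (\<Sum>i\<in>UNIV. (g s (r s) *\<^sub>R decay k lam s) $ i)) (at s within {0..T})"
        using has_real_derivative_component[OF r[OF s]] by (auto intro!: derivative_eq_intros)
      have "(\<Sum>i\<in>UNIV. (g s (r s) *\<^sub>R decay k lam s) $ i) \<le> (\<Sum>i\<in>(UNIV::'n set). g s (r s))"
        using g_nonneg[OF s] e s by (intro sum_mono) (auto intro: mult_left_le)
      also have "\<dots> = CARD('n) * g s (r s)" by simp
      also have "\<dots> \<le> B * (1 + (\<Sum>i\<in>UNIV. truncate M (r s) $ i))"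
        unfolding g_def B_def Lam_def using e s trunc by (intro eig_rate_le[OF c lam]) auto
      \<comment> \<open>Truncation only decreases nonnegative components, so the growth bound for the truncated rate
    does not involve \<open>M\<close>.\<close>
      also have "\<dots> \<le> B * ?v s"
        using B M r_nonneg[OF s]
        by (intro mult_left_mono add_left_mono sum_mono) (auto simp: truncate_def)
      finally show "(\<Sum>i\<in>UNIV. (g s (r s) *\<^sub>R decay k lam s) $ i) \<le> B * ?v s" .
    qed (rule t)
    also have "\<dots> \<le> M" using t B by (simp add: M_def r0 mult_left_mono)
    finally have "(\<Sum>i\<in>UNIV. r t $ i) \<le> M" by simp
    moreover have "r t $ i \<le> (\<Sum>i\<in>UNIV. r t $ i)"
      using r_nonneg[OF t] by (intro member_le_sum) auto
    ultimately show ?thesis by linarith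
  qed
  have "truncate M (r t) = r t" if "t \<in> {0..T}" for t
    using r_nonneg[OF that] r_le[OF that] by (simp add: truncate_def vec_eq_iff)
  then show ?thesis
    using r0 r r_nonneg by (intro exI[of _ r]) (auto simp: eig_solution_def g_def)
qed

text \<open>Two solutions are continuous on a compact interval and therefore share a box on which the rate is
  Lipschitz.\<close>

lemma eig_solution_unique:
  fixes lam :: "real ^ 'n"
  assumes c: "0 < c" and lam: "\<And>i. 0 \<le> lam $ i" and k: "0 \<le> k"
    and r: "eig_solution c k lam T r" and s: "eig_solution c k lam T s" and t: "t \<in> {0..T}"
  shows "r t = s t"
proof -
  have init: "r 0 = s 0" using r s by (simp add: eig_solution_def)
  have nonneg: "0 \<le> r u $ i" "0 \<le> s u $ i" if "u \<in> {0..T}" for u i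
    using r s that by (simp_all add: eig_solution_def)
  have r': "(r has_vector_derivative
      eig_rate c lam (decay k lam u) (r u) *\<^sub>R decay k lam u) (at u within {0..T})"
    and s': "(s has_vector_derivative
      eig_rate c lam (decay k lam u) (s u) *\<^sub>R decay k lam u) (at u within {0..T})"
    if "u \<in> {0..T}" for u
    using r s that by (simp_all add: eig_solution_def)
  have "compact (r ` {0..T} \<union> s ` {0..T})"
    using continuous_on_vector_derivative[OF r'] continuous_on_vector_derivative[OF s']
    by (intro compact_Un compact_continuous_image compact_Icc)
  then obtain M where M: "\<And>x. x \<in> r ` {0..T} \<union> s ` {0..T} \<Longrightarrow> norm x \<le> M"
    using compact_imp_bounded by (metis bounded_iff)
  let ?S = "{x :: real ^ 'n. \<forall>i. 0 \<le> x $ i \<and> x $ i \<le> M}"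
  have box: "r u \<in> ?S" "s u \<in> ?S" if "u \<in> {0..T}" for u
  proof -
    have "norm (r u) \<le> M" "norm (s u) \<le> M" using M that by auto
    then have "r u $ i \<le> M" "s u $ i \<le> M" for i
      using component_le_norm_cart[of "r u" i] component_le_norm_cart[of "s u" i] by linarith+
    then show "r u \<in> ?S" "s u \<in> ?S" using nonneg that by auto
  qed
  obtain K where K: "\<And>e. (\<forall>i. 0 \<le> e $ i \<and> e $ i \<le> 1) \<Longrightarrow> K-lipschitz_on ?S (eig_rate c lam e)"
    using eig_rate_lipschitz[OF c lam, of M] by blast
  show ?thesis
  proof (rule lipschitz_ode_unique[OF r' s' box])
    show "(K * CARD('n))-lipschitz_on ?S (\<lambda>x. eig_rate c lam (decay k lam u) x *\<^sub>R decay k lam u)"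
      if "u \<in> {0..T}" for u
      using that decay_bounds[OF k lam] by (intro lipschitz_on_scaleR_unit_box K) auto
  qed (use init t in auto)
qed

text \<open>The derivatives of the two components agree at all times. This keeps the reconstructed matrix a
  polynomial of \<open>L\<close>.\<close>

lemma eig_solution_eq_of_eq_eigenvalues:
  assumes r: "eig_solution c k lam T r" and eq: "lam $ i = lam $ j" and t: "t \<in> {0..T}"
  shows "r t $ i = r t $ j"
proof -
  have r': "(r has_vector_derivative
      eig_rate c lam (decay k lam u) (r u) *\<^sub>R decay k lam u) (at u within {0..T})"
    if "u \<in> {0..T}" for u
    using r that by (simp add: eig_solution_def)
  have "((\<lambda>t. r t $ i - r t $ j) has_vector_derivative 0) (at s within {0..T})" if "s \<in> {0..T}" for s
    using DERIV_diff[OF has_real_derivative_component[OF r'[OF that], of i]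
        has_real_derivative_component[OF r'[OF that], of j]] eq
    by (simp add: has_real_derivative_iff_has_vector_derivative decay_def)
  then obtain d where "\<And>s. s \<in> {0..T} \<Longrightarrow> r s $ i - r s $ j = d"
    using has_vector_derivative_zero_constant[of "{0..T}" "\<lambda>t. r t $ i - r t $ j"] by auto
  from this[of t] this[of 0] t r show ?thesis by (simp add: eig_solution_def)
qed

section \<open>From eigenvalues back to matrices\<close>

text \<open>Each solution of the matrix equation is diagonal in the eigenbasis at every time, and
  \<open>diag_coords\<close> and \<open>conj_diag\<close> are linear, so derivatives pass between the matrix path and its
  eigenvalues in both directions.\<close>

lemma ode_solution_conj_diag_iff:
  assumes U: "orthogonal_matrix U" and c: "0 < c" and lam: "\<And>i. 0 \<le> lam $ i" and T: "0 \<le> T"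
  shows "ode_solution a q c (conj_diag U lam) T R \<longleftrightarrow>
     (\<exists>r. eig_solution c (a + q) lam T r \<and> (\<forall>t\<in>{0..T}. R t = conj_diag U (r t)))" (is "_ \<longleftrightarrow> ?eig")
proof -
  let ?E = "\<lambda>t. decay (a + q) lam t"
  have exp: "matexp ((- t * (a + q)) *\<^sub>R conj_diag U lam) = conj_diag U (?E t)" for t
    by (simp add: matexp_conj_diag[OF U] decay_def flip: conj_diag_scaleR)
  have rhs: "(1 / c * trace (Qderiv c (conj_diag U lam) (conj_diag U x) **
        matexp ((- t * (a + q)) *\<^sub>R conj_diag U lam))) *\<^sub>R
      matexp ((- t * (a + q)) *\<^sub>R conj_diag U lam) = conj_diag U (eig_rate c lam (?E t) x *\<^sub>R ?E t)"
    if "\<And>i. 0 \<le> x $ i" for x t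
    unfolding exp eig_rate_eq_trace[OF U c lam that] by (rule conj_diag_scaleR[symmetric])
  show ?thesis
  proof
    assume R: "ode_solution a q c (conj_diag U lam) T R"
    define r where "r t = diag_coords U (R t)" for t
    have "R t = conj_diag U (r t) \<and> (\<forall>i. 0 \<le> r t $ i) \<and>
       (r has_vector_derivative eig_rate c lam (?E t) (r t) *\<^sub>R ?E t) (at t within {0..T})"
      if t: "t \<in> {0..T}" for t
    proof -
      obtain x where x: "R t = conj_diag U x" "\<And>i. 0 \<le> x $ i"
        using R t unfolding ode_solution_def psd_polys_conj_diag_iff[OF U] by blast
      then have rx: "r t = x" by (simp add: r_def diag_coords_conj_diag[OF U])
      have "(R has_vector_derivative conj_diag U (eig_rate c lam (?E t) x *\<^sub>R ?E t)) (at t within {0..T})"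
        using R t unfolding ode_solution_def rhs[OF x(2), symmetric] x(1)[symmetric] by blast
      from bounded_linear.has_vector_derivative[OF bounded_linear_diag_coords[of U] this]
      show ?thesis
        using x by (simp add: rx r_def[abs_def, symmetric] diag_coords_conj_diag[OF U])
    qed
    moreover have "r 0 = 0"
      using R bounded_linear_diag_coords[of U]
      by (simp add: r_def ode_solution_def bounded_linear.linear linear_0)
    ultimately show ?eig unfolding eig_solution_def by blast
  next
    assume ?eig
    then obtain r where r: "eig_solution c (a + q) lam T r"
      and Rr: "\<And>t. t \<in> {0..T} \<Longrightarrow> R t = conj_diag U (r t)" by blast
    have r0: "r 0 = 0" and nonneg: "\<And>t i. t \<in> {0..T} \<Longrightarrow> 0 \<le> r t $ i"
      and r': "\<And>t. t \<in> {0..T} \<Longrightarrow>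
        (r has_vector_derivative eig_rate c lam (?E t) (r t) *\<^sub>R ?E t) (at t within {0..T})"
      using r by (simp_all add: eig_solution_def)
    show "ode_solution a q c (conj_diag U lam) T R"
      unfolding ode_solution_def
    proof (intro conjI ballI)
      show "R 0 = 0"
        using Rr[of 0] T r0 bounded_linear_conj_diag[of U] by (simp add: bounded_linear.linear linear_0)
      fix t assume t: "t \<in> {0..T}"
      show "R t \<in> psd_polys (conj_diag U lam)"
        unfolding psd_polys_conj_diag_iff[OF U]
        using Rr[OF t] nonneg[OF t] eig_solution_eq_of_eq_eigenvalues[OF r _ t] by blast
      have "(R has_vector_derivative conj_diag U (eig_rate c lam (?E t) (r t) *\<^sub>R ?E t)) (at t within {0..T})"
        by (rule has_vector_derivative_transform[OF t Rr
              bounded_linear.has_vector_derivative[OF bounded_linear_conj_diag r'[OF t]]])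
      then show "(R has_vector_derivative
          (1 / c * trace (Qderiv c (conj_diag U lam) (R t) ** matexp ((- t * (a + q)) *\<^sub>R conj_diag U lam))) *\<^sub>R
            matexp ((- t * (a + q)) *\<^sub>R conj_diag U lam)) (at t within {0..T})"
        unfolding Rr[OF t] rhs[OF nonneg[OF t]] .
    qed
  qed
qed

theorem theorem4p7:
  fixes adj :: "'n::finite \<Rightarrow> 'n \<Rightarrow> bool"
    and L :: "real ^ 'n ^ 'n"
    and a q c T :: real
  assumes "simple_graph adj"
    and "connected_graph adj"
    and "vertex_transitive adj"
    and "L = norm_laplacian adj"
    and "0 \<le> a" and "0 \<le> q" and "0 < c" and "0 < T"
  shows "\<exists>R. ode_solution a q c L T R \<and>
      (\<forall>S. ode_solution a q c L T S \<longrightarrow> (\<forall>t\<in>{0..T}. S t = R t))"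
proof -
  have psd: "pos_semidef L" using pos_semidef_norm_laplacian assms(1,4) by blast
  then obtain U lam where U: "orthogonal_matrix U" and L: "L = conj_diag U lam"
    using symmetric_matrix_conj_diag[of L] unfolding pos_semidef_def by blast
  have lam: "0 \<le> lam $ i" for i using psd pos_semidef_conj_diag[OF U] unfolding L by blast
  have k: "0 \<le> a + q" using assms by simp
  note iff = ode_solution_conj_diag_iff[OF U \<open>0 < c\<close> lam less_imp_le[OF \<open>0 < T\<close>]]
  obtain r where r: "eig_solution c (a + q) lam T r"
    using eig_solution_exists[OF \<open>0 < c\<close> lam k \<open>0 < T\<close>] by blast
  have sol: "ode_solution a q c L T (\<lambda>t. conj_diag U (r t))"
    unfolding L iff using r by blast
  have "S t = conj_diag U (r t)" if S: "ode_solution a q c L T S" and t: "t \<in> {0..T}" for S t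
  proof -
    have "\<exists>s. eig_solution c (a + q) lam T s \<and> (\<forall>t\<in>{0..T}. S t = conj_diag U (s t))"
      using S unfolding L iff .
    then obtain s where s: "eig_solution c (a + q) lam T s" and Ss: "\<forall>t\<in>{0..T}. S t = conj_diag U (s t)"
      by blast
    have "s t = r t" by (rule eig_solution_unique[OF \<open>0 < c\<close> lam k s r t])
    then show ?thesis using Ss t by simp
  qed
  with sol show ?thesis by (intro exI[of _ "\<lambda>t. conj_diag U (r t)"]) simp
qed

end
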